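(* Let $S$ be an arbitrary $\mathbb{C}$-algebra upon which a finite group $G$ acts by automorphisms, and let $A=S\#G$. For each $p$, the map $$\Theta^*\circ\mathcal R:\mathrm{Hom}_{\mathbb C}(S^{\otimes p},A)\to\mathrm{Hom}_{\mathbb C}(A^{\otimes p},A)$$ given by $$\big((\Theta^*\circ\mathcal R)(\beta)\big)(f_1\overline{g}_1\otimes\cdots\otimes f_p\overline{g}_p)=\frac1{|G|}\sum_{g\in G}({}^g\beta)\big(f_1\otimes{}^{g_1}f_2\otimes\cdots\otimes{}^{g_1\cdots g_{p-1}}f_p\big)\,\overline{g_1\cdots g_p}$$ for all $f_1,\dots,f_p\in S$, $g_1,\dots,g_p\in G$ and $\beta\in\mathrm{Hom}_{\mathbb C}(S^{\otimes p},A)$, induces an isomorphism $$\mathrm{HH}^p(S,A)^G\xrightarrow{\ \sim\ }\mathrm{HH}^p(A).$$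
   Context: The skew group algebra $S\#G$ is the vector space $S\otimes\mathbb{C}G$, with $s\otimes g$ written $s\overline g$, and multiplication $(r\overline g)(s\overline h)=r({}^gs)\overline{gh}$; $S$ embeds in it. $G$ acts on $A$ by conjugation by the elements $\overline g$, and on maps by $({}^g\beta)(x)={}^g(\beta({}^{g^{-1}}x))$ (diagonal action on $S^{\otimes p}$). $\mathrm{HH}^\bullet(A,M)=\mathrm{Ext}^\bullet_{A\otimes A^{op}}(A,M)$ and $\mathrm{HH}^\bullet(A)=\mathrm{HH}^\bullet(A,A)$, computed by the bar resolution, with $p$-cochains $\mathrm{Hom}_{\mathbb C}(A^{\otimes p},M)\cong\mathrm{Hom}_{A\otimes A^{op}}(A^{\otimes(p+2)},M)$; similarly $\mathrm{HH}^\bullet(S,A)$ is computed by $\mathrm{Hom}_{\mathbb C}(S^{\otimes p},A)$, and $G$ acts on it through the action on cochains. $\mathcal R(\gamma)=\frac1{|G|}\sum_{g\in G}{}^g\gamma$ is the averaging (Reynolds) operator, and $\Theta^*:\mathrm{Hom}_{\mathbb C}(S^{\otimes p},A)^G\to\mathrm{Hom}_{\mathbb C}(A^{\otimes p},A)$ is $\Theta^*(\kappa)(f_1\overline g_1\otimes\cdots\otimes f_p\overline g_p)=\kappa(f_1\otimes{}^{g_1}f_2\otimes\cdots\otimes{}^{g_1\cdots g_{p-1}}f_p)\,\overline{g_1\cdots g_p}$. *)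

theory Defs
  imports Complex_Main "HOL-Library.Function_Algebras" "HOL-Library.Set_Algebras"
begin

text \<open>Associative unital complex algebras.  The sort \<open>{ring, monoid_mult}\<close> is used instead of
  \<open>ring_1\<close> because the latter would exclude the zero algebra.\<close>

locale complex_algebra = vector_space scale
  for scale :: "complex \<Rightarrow> 's::{ring,monoid_mult} \<Rightarrow> 's" +
  assumes scale_mult_left: "scale c x * y = scale c (x * y)"
    and scale_mult_right: "x * scale c y = scale c (x * y)"

text \<open>The group is a type of class \<open>group_add\<close>, the library's class of arbitrary (not
  necessarily commutative) groups.  Its operation is written additively: \<open>g + h\<close> is the product
  $gh$, \<open>0\<close> is the neutral element, \<open>- g\<close> is the inverse of $g$, and
  \<open>sum_list [g\<^sub>1, \<dots>, g\<^sub>p]\<close> is the ordered product $g_1 \cdots g_p$.\<close>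

locale finite_group_action = complex_algebra scale
  for scale :: "complex \<Rightarrow> 's::{ring,monoid_mult} \<Rightarrow> 's" +
  fixes act :: "'g::{group_add,finite} \<Rightarrow> 's \<Rightarrow> 's"
  assumes act_zero: "act 0 x = x"
    and act_add: "act (g + h) x = act g (act h x)"
    and act_linear: "Vector_Spaces.linear scale scale (act g)"
    and act_mult: "act g (x * y) = act g x * act g y"
    and act_one: "act g 1 = 1"


section \<open>Hochschild cohomology\<close>

text \<open>A $p$-cochain $A^{\otimes p} \to M$ is a multilinear map on lists of length \<open>p\<close>.  It is set
  to 0 on lists of any other length, so that cochains form a subspace of \<open>'a list \<Rightarrow> 'm\<close>.\<close>

definition cochains ::
  "(complex \<Rightarrow> 'a \<Rightarrow> 'a) \<Rightarrow> (complex \<Rightarrow> 'm \<Rightarrow> 'm) \<Rightarrow> nat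
    \<Rightarrow> ('a::ab_group_add list \<Rightarrow> 'm::ab_group_add) set" where
  "cochains sA sM p = {f.
     (\<forall>xs. length xs \<noteq> p \<longrightarrow> f xs = 0) \<and>
     (\<forall>xs i. length xs = p \<longrightarrow> i < p \<longrightarrow> Vector_Spaces.linear sA sM (\<lambda>x. f (xs[i := x])))}"

definition cochain_scale :: "(complex \<Rightarrow> 'm \<Rightarrow> 'm) \<Rightarrow> complex \<Rightarrow> ('a list \<Rightarrow> 'm) \<Rightarrow> 'a list \<Rightarrow> 'm" where
  "cochain_scale sM c f = (\<lambda>xs. sM c (f xs))"

text \<open>The differential of the bar complex of an algebra with multiplication \<open>mul\<close>, with
  coefficients in a bimodule with left action \<open>lm\<close> and right action \<open>rm\<close>.\<close>

definition hochschild_d ::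
  "('a \<Rightarrow> 'a \<Rightarrow> 'a) \<Rightarrow> (complex \<Rightarrow> 'm \<Rightarrow> 'm) \<Rightarrow> ('a \<Rightarrow> 'm \<Rightarrow> 'm) \<Rightarrow> ('m \<Rightarrow> 'a \<Rightarrow> 'm) \<Rightarrow> nat
    \<Rightarrow> ('a list \<Rightarrow> 'm::ab_group_add) \<Rightarrow> 'a list \<Rightarrow> 'm" where
  "hochschild_d mul sM lm rm p f = (\<lambda>xs.
     if length xs = Suc p
     then lm (hd xs) (f (tl xs))
       + (\<Sum>i<p. sM ((-1) ^ Suc i)
            (f (take i xs @ [mul (xs ! i) (xs ! Suc i)] @ drop (Suc (Suc i)) xs)))
       + sM ((-1) ^ Suc p) (rm (f (butlast xs)) (last xs))
     else 0)"

definition cocycles ::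
  "(complex \<Rightarrow> 'a \<Rightarrow> 'a) \<Rightarrow> ('a \<Rightarrow> 'a \<Rightarrow> 'a) \<Rightarrow> (complex \<Rightarrow> 'm \<Rightarrow> 'm) \<Rightarrow> ('a \<Rightarrow> 'm \<Rightarrow> 'm)
    \<Rightarrow> ('m \<Rightarrow> 'a \<Rightarrow> 'm) \<Rightarrow> nat \<Rightarrow> ('a::ab_group_add list \<Rightarrow> 'm::ab_group_add) set" where
  "cocycles sA mul sM lm rm p = {f \<in> cochains sA sM p. hochschild_d mul sM lm rm p f = 0}"

definition coboundaries ::
  "(complex \<Rightarrow> 'a \<Rightarrow> 'a) \<Rightarrow> ('a \<Rightarrow> 'a \<Rightarrow> 'a) \<Rightarrow> (complex \<Rightarrow> 'm \<Rightarrow> 'm) \<Rightarrow> ('a \<Rightarrow> 'm \<Rightarrow> 'm)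
    \<Rightarrow> ('m \<Rightarrow> 'a \<Rightarrow> 'm) \<Rightarrow> nat \<Rightarrow> ('a::ab_group_add list \<Rightarrow> 'm::ab_group_add) set" where
  "coboundaries sA mul sM lm rm p =
     (case p of 0 \<Rightarrow> {0} | Suc q \<Rightarrow> hochschild_d mul sM lm rm q ` cochains sA sM q)"


section \<open>Quotient vector spaces\<close>

text \<open>Elements of a quotient \<open>Z / B\<close> are the cosets \<open>z +o B\<close>, and addition of cosets is addition
  of sets.\<close>

definition quotient_space :: "'m::plus set \<Rightarrow> 'm set \<Rightarrow> 'm set set" where
  "quotient_space Z B = (\<lambda>z. z +o B) ` Z"

text \<open>The map of quotients induced by \<open>F\<close>, with target modulo \<open>B\<close>.  If \<open>F\<close> is additive and
  maps the subspace factored out of its domain into \<open>B\<close>, then all members of the union coincide.\<close>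

definition induced_map :: "'n::plus set \<Rightarrow> ('m \<Rightarrow> 'n) \<Rightarrow> 'm set \<Rightarrow> 'n set" where
  "induced_map B F X = (\<Union>x\<in>X. F x +o B)"

definition linear_isomorphism ::
  "(complex \<Rightarrow> 'v \<Rightarrow> 'v) \<Rightarrow> (complex \<Rightarrow> 'w \<Rightarrow> 'w) \<Rightarrow> 'v::plus set \<Rightarrow> 'w::plus set \<Rightarrow> ('v \<Rightarrow> 'w) \<Rightarrow> bool"
  where
  "linear_isomorphism sV sW V W \<phi> \<longleftrightarrow>
     (\<forall>x\<in>V. \<forall>y\<in>V. \<phi> (x + y) = \<phi> x + \<phi> y) \<and>
     (\<forall>c. \<forall>x\<in>V. \<phi> (sV c x) = sW c (\<phi> x)) \<and>
     bij_betw \<phi> V W"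


section \<open>The skew group algebra\<close>

text \<open>Since the group is finite, $S \otimes \mathbb{C}G$ is the space of all functions
  \<open>'g \<Rightarrow> 's\<close>; the function \<open>a\<close> stands for $\sum_g a(g)\,\overline{g}$.\<close>

definition skew_elem :: "'s::zero \<Rightarrow> 'g \<Rightarrow> 'g \<Rightarrow> 's" where
  "skew_elem s g = (\<lambda>h. if h = g then s else 0)"

definition skew_scale :: "(complex \<Rightarrow> 's \<Rightarrow> 's) \<Rightarrow> complex \<Rightarrow> ('g \<Rightarrow> 's) \<Rightarrow> 'g \<Rightarrow> 's" where
  "skew_scale scale c a = (\<lambda>g. scale c (a g))"

definition skew_mult ::
  "('g::{group_add,finite} \<Rightarrow> 's::{ring,monoid_mult} \<Rightarrow> 's) \<Rightarrow> ('g \<Rightarrow> 's) \<Rightarrow> ('g \<Rightarrow> 's) \<Rightarrow> 'g \<Rightarrow> 's" where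
  "skew_mult act a b = (\<lambda>k. \<Sum>g\<in>UNIV. a g * act g (b (- g + k)))"

lemma (in finite_group_action) skew_mult_skew_elem:
  "skew_mult act (skew_elem r g) (skew_elem s h) = skew_elem (r * act g s) (g + h)"
proof
  fix k
  have act0: "act g 0 = 0" for g
    using act_linear[of g] by (simp add: Vector_Spaces.linear_iff_module_hom module_hom.zero)
  have "skew_mult act (skew_elem r g) (skew_elem s h) k
      = (\<Sum>g'\<in>UNIV. if g' = g then r * act g (skew_elem s h (- g + k)) else 0)"
    unfolding skew_mult_def by (rule sum.cong) (auto simp: skew_elem_def)
  also have "\<dots> = r * act g (skew_elem s h (- g + k))"
    by simp
  also have "\<dots> = skew_elem (r * act g s) (g + h) k"
  proof -
    have "- g + k = h \<longleftrightarrow> k = g + h"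
      by (metis add.assoc add.left_inverse add.right_inverse add_0)
    then show ?thesis
      by (auto simp: skew_elem_def act0)
  qed
  finally show "skew_mult act (skew_elem r g) (skew_elem s h) k
      = skew_elem (r * act g s) (g + h) k" .
qed

definition skew_embed :: "'s::zero \<Rightarrow> 'g::group_add \<Rightarrow> 's" where
  "skew_embed s = skew_elem s 0"

definition skew_conj ::
  "('g::{group_add,finite} \<Rightarrow> 's::{ring,monoid_mult} \<Rightarrow> 's) \<Rightarrow> 'g \<Rightarrow> ('g \<Rightarrow> 's) \<Rightarrow> 'g \<Rightarrow> 's" where
  "skew_conj act g a = skew_mult act (skew_mult act (skew_elem 1 g) a) (skew_elem 1 (- g))"


section \<open>The cohomology of the skew group algebra\<close>

text \<open>The suffix \<open>SA\<close> refers to $\mathrm{HH}^\bullet(S, A)$ and \<open>AA\<close> to $\mathrm{HH}^\bullet(A)$.\<close>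

definition cochains_SA ::
  "(complex \<Rightarrow> 's::{ring,monoid_mult} \<Rightarrow> 's) \<Rightarrow> nat \<Rightarrow> ('s list \<Rightarrow> 'g::{group_add,finite} \<Rightarrow> 's) set" where
  "cochains_SA scale p = cochains scale (skew_scale scale) p"

definition cocycles_SA ::
  "(complex \<Rightarrow> 's::{ring,monoid_mult} \<Rightarrow> 's) \<Rightarrow> ('g::{group_add,finite} \<Rightarrow> 's \<Rightarrow> 's) \<Rightarrow> nat
    \<Rightarrow> ('s list \<Rightarrow> 'g \<Rightarrow> 's) set" where
  "cocycles_SA scale act p = cocycles scale (*) (skew_scale scale)
     (\<lambda>s a. skew_mult act (skew_embed s) a) (\<lambda>a s. skew_mult act a (skew_embed s)) p"

definition coboundaries_SA ::
  "(complex \<Rightarrow> 's::{ring,monoid_mult} \<Rightarrow> 's) \<Rightarrow> ('g::{group_add,finite} \<Rightarrow> 's \<Rightarrow> 's) \<Rightarrow> nat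
    \<Rightarrow> ('s list \<Rightarrow> 'g \<Rightarrow> 's) set" where
  "coboundaries_SA scale act p = coboundaries scale (*) (skew_scale scale)
     (\<lambda>s a. skew_mult act (skew_embed s) a) (\<lambda>a s. skew_mult act a (skew_embed s)) p"

definition HH_SA ::
  "(complex \<Rightarrow> 's::{ring,monoid_mult} \<Rightarrow> 's) \<Rightarrow> ('g::{group_add,finite} \<Rightarrow> 's \<Rightarrow> 's) \<Rightarrow> nat
    \<Rightarrow> ('s list \<Rightarrow> 'g \<Rightarrow> 's) set set" where
  "HH_SA scale act p = quotient_space (cocycles_SA scale act p) (coboundaries_SA scale act p)"

definition HH_SA_scale ::
  "(complex \<Rightarrow> 's::{ring,monoid_mult} \<Rightarrow> 's) \<Rightarrow> ('g::{group_add,finite} \<Rightarrow> 's \<Rightarrow> 's) \<Rightarrow> nat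
    \<Rightarrow> complex \<Rightarrow> ('s list \<Rightarrow> 'g \<Rightarrow> 's) set \<Rightarrow> ('s list \<Rightarrow> 'g \<Rightarrow> 's) set" where
  "HH_SA_scale scale act p c =
     induced_map (coboundaries_SA scale act p) (cochain_scale (skew_scale scale) c)"

definition cochains_AA ::
  "(complex \<Rightarrow> 's::{ring,monoid_mult} \<Rightarrow> 's) \<Rightarrow> nat
    \<Rightarrow> (('g::{group_add,finite} \<Rightarrow> 's) list \<Rightarrow> 'g \<Rightarrow> 's) set" where
  "cochains_AA scale p = cochains (skew_scale scale) (skew_scale scale) p"

definition cocycles_AA ::
  "(complex \<Rightarrow> 's::{ring,monoid_mult} \<Rightarrow> 's) \<Rightarrow> ('g::{group_add,finite} \<Rightarrow> 's \<Rightarrow> 's) \<Rightarrow> nat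
    \<Rightarrow> (('g \<Rightarrow> 's) list \<Rightarrow> 'g \<Rightarrow> 's) set" where
  "cocycles_AA scale act p = cocycles (skew_scale scale) (skew_mult act) (skew_scale scale)
     (skew_mult act) (skew_mult act) p"

definition coboundaries_AA ::
  "(complex \<Rightarrow> 's::{ring,monoid_mult} \<Rightarrow> 's) \<Rightarrow> ('g::{group_add,finite} \<Rightarrow> 's \<Rightarrow> 's) \<Rightarrow> nat
    \<Rightarrow> (('g \<Rightarrow> 's) list \<Rightarrow> 'g \<Rightarrow> 's) set" where
  "coboundaries_AA scale act p = coboundaries (skew_scale scale) (skew_mult act) (skew_scale scale)
     (skew_mult act) (skew_mult act) p"

definition HH_AA ::
  "(complex \<Rightarrow> 's::{ring,monoid_mult} \<Rightarrow> 's) \<Rightarrow> ('g::{group_add,finite} \<Rightarrow> 's \<Rightarrow> 's) \<Rightarrow> nat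
    \<Rightarrow> (('g \<Rightarrow> 's) list \<Rightarrow> 'g \<Rightarrow> 's) set set" where
  "HH_AA scale act p = quotient_space (cocycles_AA scale act p) (coboundaries_AA scale act p)"

definition HH_AA_scale ::
  "(complex \<Rightarrow> 's::{ring,monoid_mult} \<Rightarrow> 's) \<Rightarrow> ('g::{group_add,finite} \<Rightarrow> 's \<Rightarrow> 's) \<Rightarrow> nat
    \<Rightarrow> complex \<Rightarrow> (('g \<Rightarrow> 's) list \<Rightarrow> 'g \<Rightarrow> 's) set \<Rightarrow> (('g \<Rightarrow> 's) list \<Rightarrow> 'g \<Rightarrow> 's) set" where
  "HH_AA_scale scale act p c =
     induced_map (coboundaries_AA scale act p) (cochain_scale (skew_scale scale) c)"


section \<open>Group action, averaging, and extension of cochains\<close>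

definition cochain_act ::
  "('g::{group_add,finite} \<Rightarrow> 's::{ring,monoid_mult} \<Rightarrow> 's) \<Rightarrow> 'g
    \<Rightarrow> ('s list \<Rightarrow> 'g \<Rightarrow> 's) \<Rightarrow> 's list \<Rightarrow> 'g \<Rightarrow> 's" where
  "cochain_act act g \<beta> = (\<lambda>fs. skew_conj act g (\<beta> (map (act (- g)) fs)))"

definition HH_SA_invariants ::
  "(complex \<Rightarrow> 's::{ring,monoid_mult} \<Rightarrow> 's) \<Rightarrow> ('g::{group_add,finite} \<Rightarrow> 's \<Rightarrow> 's) \<Rightarrow> nat
    \<Rightarrow> ('s list \<Rightarrow> 'g \<Rightarrow> 's) set set" where
  "HH_SA_invariants scale act p =
     {X \<in> HH_SA scale act p.
        \<forall>g. induced_map (coboundaries_SA scale act p) (cochain_act act g) X = X}"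

definition reynolds ::
  "(complex \<Rightarrow> 's::{ring,monoid_mult} \<Rightarrow> 's) \<Rightarrow> ('g::{group_add,finite} \<Rightarrow> 's \<Rightarrow> 's)
    \<Rightarrow> ('s list \<Rightarrow> 'g \<Rightarrow> 's) \<Rightarrow> 's list \<Rightarrow> 'g \<Rightarrow> 's" where
  "reynolds scale act \<gamma> =
     cochain_scale (skew_scale scale) (1 / of_nat (card (UNIV :: 'g set)))
       (\<Sum>g\<in>UNIV. cochain_act act g \<gamma>)"

text \<open>\<open>twist act [f\<^sub>1, \<dots>, f\<^sub>p] [g\<^sub>1, \<dots>, g\<^sub>p]\<close> is the list with entries
  $f_1,\ {}^{g_1}f_2,\ \dots,\ {}^{g_1 \cdots g_{p-1}}f_p$.\<close>

definition twist :: "('g::monoid_add \<Rightarrow> 's \<Rightarrow> 's) \<Rightarrow> 's list \<Rightarrow> 'g list \<Rightarrow> 's list" where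
  "twist act fs gs = map (\<lambda>i. act (sum_list (take i gs)) (fs ! i)) [0..<length fs]"

text \<open>The map $\Theta^*$, given on arbitrary arguments by multilinear expansion in the coordinates
  $a_i = \sum_g a_i(g)\,\overline{g}$.\<close>

definition theta_star ::
  "('g::{group_add,finite} \<Rightarrow> 's::{ring,monoid_mult} \<Rightarrow> 's)
    \<Rightarrow> ('s list \<Rightarrow> 'g \<Rightarrow> 's) \<Rightarrow> ('g \<Rightarrow> 's) list \<Rightarrow> 'g \<Rightarrow> 's" where
  "theta_star act \<kappa> = (\<lambda>as. \<Sum>gs | length gs = length as.
     skew_mult act (\<kappa> (twist act (map2 (\<lambda>a g. a g) as gs) gs)) (skew_elem 1 (sum_list gs)))"

end

theory Submission
  imports Defs
begin

text \<open>
  Restriction of cochains along $S \to A$ is left inverse to $\Theta^*$ on $G$-invariant cochains,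
  and $\Theta^*$ commutes with the differentials there; this gives injectivity, since an invariant
  class is represented by the average of any of its members.

  For surjectivity, a cocycle $f$ on $A$ is changed by coboundaries until it vanishes as soon as one
  of its arguments lies in $G$. If $f$ already vanishes when one of the first $k$ arguments lies in
  $G$, then subtracting the coboundary of
  $(-1)^k \frac{1}{|G|} \sum_g f(a_1, \dots, a_k \overline{g}, \overline{g}^{-1}, a_{k+1}, \dots)$
  achieves the same for the first $k + 1$ arguments. The cocycle identity then shows that elements
  of $G$ can be moved across tensor signs, so that $f$ is determined by its restriction to $S$, which
  is $G$-invariant, and $f$ is the image under $\Theta^*$ of that restriction.
\<close>

section \<open>The bar complex\<close>

text \<open>Why the averaged cochain corrects \<open>f\<close>: the pair g, g^{-1} inserted at place
  \<open>k\<close> is cancelled by face \<open>k\<close>, so the cocycle identity for the lengthened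
  list expresses \<open>f\<close> through the faces beyond \<open>k\<close>. These commute with the
  insertion, except for the face that multiplies g^{-1} into the next entry. If that entry is a
  group element h, the translation g -> hg of the summation variable repairs this; the average is
  taken for the sake of this one face. The sign (-1)^k is that of face \<open>k\<close>. The places
  are treated from left to right because the faces before \<open>k\<close> must drop out: they push
  g^{-1} to place \<open>k\<close>, where \<open>f\<close> already vanishes. Invariance and the
  formula for \<open>theta_star\<close> both come from sliding a group element from the left
  bimodule slot to the right one: it translates every ring element that it passes and collects the
  group elements that it meets. For this reason cochains are extended so that the bimodule slots
  become list entries.\<close>

fun merge :: "('a \<Rightarrow> 'a \<Rightarrow> 'a) \<Rightarrow> nat \<Rightarrow> 'a list \<Rightarrow> 'a list" where
  "merge m 0 (x # y # zs) = m x y # zs"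
| "merge m (Suc i) (x # xs) = x # merge m i xs"
| "merge m _ xs = xs"

text \<open>If \<open>v\<close> is inverse to \<open>u\<close>, this is a section of the face
  \<open>merge m k\<close>; the averaged cochain is built from it.\<close>

fun expand :: "('a \<Rightarrow> 'a \<Rightarrow> 'a) \<Rightarrow> nat \<Rightarrow> 'a \<Rightarrow> 'a \<Rightarrow> 'a list \<Rightarrow> 'a list" where
  "expand m 0 u v (x # xs) = m x u # v # xs"
| "expand m (Suc k) u v (x # xs) = x # expand m k u v xs"
| "expand m k u v [] = []"

lemma length_merge [simp]: "Suc i < length xs \<Longrightarrow> length (merge m i xs) = length xs - 1"
  by (induction m i xs rule: merge.induct) auto

lemma nth_merge:
  "Suc i < length xs \<Longrightarrow> Suc j < length xs \<Longrightarrow>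
    merge m i xs ! j = (if j < i then xs ! j else if j = i then m (xs ! i) (xs ! Suc i) else xs ! Suc j)"
proof (induction m i xs arbitrary: j rule: merge.induct)
  case (1 m x y zs)
  then show ?case by (cases j) auto
next
  case (2 m i x xs)
  then show ?case by (cases j) auto
qed auto

lemma merge_conv_take_drop:
  "Suc i < length xs \<Longrightarrow>
    merge m i xs = take i xs @ [m (xs ! i) (xs ! Suc i)] @ drop (Suc (Suc i)) xs"
  by (induction m i xs rule: merge.induct) auto

lemma length_expand [simp]: "k < length xs \<Longrightarrow> length (expand m k u v xs) = Suc (length xs)"
  by (induction m k u v xs rule: expand.induct) auto

lemma nth_expand:
  "k < length xs \<Longrightarrow> j \<le> length xs \<Longrightarrow>
    expand m k u v xs ! j =
      (if j < k then xs ! j else if j = k then m (xs ! k) u else if j = Suc k then v else xs ! (j - 1))"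
proof (induction m k u v xs arbitrary: j rule: expand.induct)
  case (1 m u v x xs)
  then show ?case by (auto simp: nth_Cons split: nat.splits)
next
  case (2 m k u v x xs)
  then show ?case by (cases j) (auto simp: nth_Cons split: nat.splits)
qed auto

lemma map_merge:
  assumes "\<And>x y. h (m x y) = m' (h x) (h y)"
  shows "map h (merge m i xs) = merge m' i (map h xs)"
  using assms by (induction m i xs rule: merge.induct) auto

lemma merge_update:
  assumes "Suc i < length xs" "j < length xs"
  shows "merge m i (xs[j := x]) =
    (if j < i then (merge m i xs)[j := x] else if j = i then (merge m i xs)[i := m x (xs ! Suc i)]
     else if j = Suc i then (merge m i xs)[i := m (xs ! i) x] else (merge m i xs)[j - 1 := x])"
  by (rule nth_equalityI) (use assms in \<open>auto simp: nth_merge nth_list_update\<close>)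

lemma expand_update:
  assumes "k < length xs" "j < length xs"
  shows "expand m k u v (xs[j := x]) =
    (if j < k then (expand m k u v xs)[j := x] else if j = k then (expand m k u v xs)[k := m x u]
     else (expand m k u v xs)[Suc j := x])"
  by (rule nth_equalityI) (use assms in \<open>auto simp: nth_expand nth_list_update\<close>)

text \<open>The simplicial identity d_i d_{j+1} = d_j d_i; associativity enters in the case
  \<open>i = j\<close>.\<close>

lemma merge_merge:
  assumes assoc: "\<And>x y z. m (m x y) z = m x (m y z)"
    and "i \<le> j" "Suc (Suc j) < length xs"
  shows "merge m i (merge m (Suc j) xs) = merge m j (merge m i xs)"
  by (rule nth_equalityI) (use assms in \<open>auto simp: nth_merge\<close>)

lemma merge_expand_less:
  assumes assoc: "\<And>x y z. m (m x y) z = m x (m y z)"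
    and "i < k" "k < length xs"
  shows "merge m i (expand m k u v xs) = expand m (k - 1) u v (merge m i xs)"
  by (rule nth_equalityI) (use assms in \<open>auto simp: nth_merge nth_expand\<close>)

text \<open>The case \<open>i = k\<close> is excluded: there the inserted \<open>v\<close> is
  multiplied into the next entry, and only a sum over the group repairs this.\<close>

lemma merge_expand_greater:
  assumes "k < i" "Suc i < length xs"
  shows "merge m (Suc i) (expand m k u v xs) = expand m k u v (merge m i xs)"
proof (rule nth_equalityI)
  show "length (merge m (Suc i) (expand m k u v xs)) = length (expand m k u v (merge m i xs))"
    using assms by simp
  fix j assume "j < length (merge m (Suc i) (expand m k u v xs))"
  then show "merge m (Suc i) (expand m k u v xs) ! j = expand m k u v (merge m i xs) ! j"
    using assms by (cases j) (auto simp: nth_merge nth_expand)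
qed

section \<open>Multilinear maps and the Hochschild differential of a bimodule\<close>

definition multilinear ::
  "(complex \<Rightarrow> 'a \<Rightarrow> 'a) \<Rightarrow> (complex \<Rightarrow> 'm \<Rightarrow> 'm) \<Rightarrow> nat
    \<Rightarrow> ('a::ab_group_add list \<Rightarrow> 'm::ab_group_add) \<Rightarrow> bool" where
  "multilinear sA sM n F \<longleftrightarrow>
     (\<forall>xs i. length xs = n \<longrightarrow> i < n \<longrightarrow> Vector_Spaces.linear sA sM (\<lambda>x. F (xs[i := x])))"

lemma cochains_iff:
  "f \<in> cochains sA sM p \<longleftrightarrow> (\<forall>xs. length xs \<noteq> p \<longrightarrow> f xs = 0) \<and> multilinear sA sM p f"
  by (auto simp: cochains_def multilinear_def)

text \<open>The index pairs are split at the diagonal and both parts are written over the same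
  triangle, so that terms equated by the simplicial identity stand side by side.\<close>

lemma sum_swap_upper_triangle:
  fixes t :: "nat \<Rightarrow> nat \<Rightarrow> 'm::comm_monoid_add"
  shows "(\<Sum>j<Suc n. \<Sum>i<n. t j i) = (\<Sum>j<n. \<Sum>i\<le>j. t (Suc j) i) + (\<Sum>j<n. \<Sum>i\<le>j. t i j)"
proof (induction n)
  case (Suc n)
  have eq: "(\<Sum>j<Suc (Suc n). \<Sum>i<Suc n. t j i)
      = (\<Sum>j<Suc n. \<Sum>i<n. t j i) + (\<Sum>j<Suc n. t j n) + (\<Sum>i<Suc n. t (Suc n) i)"
    by (simp add: sum.distrib add_ac)
  show ?case
    unfolding eq Suc.IH by (simp add: lessThan_Suc_atMost[symmetric] add_ac)
qed simp

text \<open>The product and the actions are parameters because there are two instances: S acting on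
  A through the embedding, and A acting on itself by the skew product, which is not the pointwise
  product of functions.\<close>

locale algebra_bimodule = A: vector_space sA + M: vector_space sM
  for sA :: "complex \<Rightarrow> 'a::ab_group_add \<Rightarrow> 'a" and sM :: "complex \<Rightarrow> 'm::ab_group_add \<Rightarrow> 'm" +
  fixes mul :: "'a \<Rightarrow> 'a \<Rightarrow> 'a" and one :: 'a
    and lm :: "'a \<Rightarrow> 'm \<Rightarrow> 'm" and rm :: "'m \<Rightarrow> 'a \<Rightarrow> 'm"
  assumes linear_mul_left: "Vector_Spaces.linear sA sA (\<lambda>x. mul x y)"
    and linear_mul_right: "Vector_Spaces.linear sA sA (mul x)"
    and linear_lm_left: "Vector_Spaces.linear sA sM (\<lambda>x. lm x u)"
    and linear_lm_right: "Vector_Spaces.linear sM sM (lm x)"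
    and linear_rm_left: "Vector_Spaces.linear sM sM (\<lambda>u. rm u x)"
    and linear_rm_right: "Vector_Spaces.linear sA sM (rm u)"
    and mul_assoc: "mul (mul x y) z = mul x (mul y z)"
    and mul_one_left [simp]: "mul one x = x"
    and mul_one_right [simp]: "mul x one = x"
    and lm_mul: "lm (mul x y) u = lm x (lm y u)"
    and rm_mul: "rm u (mul x y) = rm (rm u x) y"
    and rm_lm: "rm (lm x u) y = lm x (rm u y)"
    and lm_one [simp]: "lm one u = u"
    and rm_one [simp]: "rm u one = u"
begin

abbreviation "d \<equiv> hochschild_d mul sM lm rm"
abbreviation "C \<equiv> cochains sA sM"
abbreviation "Z \<equiv> cocycles sA mul sM lm rm"
abbreviation "B \<equiv> coboundaries sA mul sM lm rm"

sublocale AM: vector_space_pair sA sM ..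

sublocale F: vector_space "cochain_scale sM :: complex \<Rightarrow> ('a list \<Rightarrow> 'm) \<Rightarrow> 'a list \<Rightarrow> 'm"
  by unfold_locales
    (auto simp: cochain_scale_def fun_eq_iff M.scale_right_distrib M.scale_left_distrib)

lemmas lm_hom = linear_lm_right[unfolded Vector_Spaces.linear_iff_module_hom]
lemmas rm_hom = linear_rm_left[unfolded Vector_Spaces.linear_iff_module_hom]
lemmas lm_simps = lm_hom[THEN module_hom.add] lm_hom[THEN module_hom.scale]
  lm_hom[THEN module_hom.sum] lm_hom[THEN module_hom.zero]
lemmas rm_simps = rm_hom[THEN module_hom.add] rm_hom[THEN module_hom.scale]
  rm_hom[THEN module_hom.sum] rm_hom[THEN module_hom.zero]

lemma d_eq:
  "d p f xs = (if length xs = Suc p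
     then lm (hd xs) (f (tl xs)) + (\<Sum>i<p. sM ((-1) ^ Suc i) (f (merge mul i xs)))
       + sM ((-1) ^ Suc p) (rm (f (butlast xs)) (last xs))
     else 0)"
  unfolding hochschild_d_def
  by (auto intro!: sum.cong simp: merge_conv_take_drop)

lemma multilinear_merge:
  assumes F: "multilinear sA sM n F" and i: "i < n"
  shows "multilinear sA sM (Suc n) (\<lambda>xs. F (merge mul i xs))"
  unfolding multilinear_def
proof (intro allI impI)
  fix xs :: "'a list" and j
  assume len: "length xs = Suc n" and j: "j < Suc n"
  let ?ys = "merge mul i xs"
  have lin: "Vector_Spaces.linear sA sM (\<lambda>x. F (?ys[l := x]))" if "l < n" for l
    using F that len i by (auto simp: multilinear_def)
  have ends: "Vector_Spaces.linear sA sM (\<lambda>x. F (?ys[i := mul x (xs ! Suc i)]))"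
    "Vector_Spaces.linear sA sM (\<lambda>x. F (?ys[i := mul (xs ! i) x]))"
    using Vector_Spaces.linear_compose[OF linear_mul_left lin[OF i]]
      Vector_Spaces.linear_compose[OF linear_mul_right lin[OF i]] by (simp_all add: o_def)
  consider "j < i" | "j = i" | "j = Suc i" | "Suc i < j" by linarith
  then show "Vector_Spaces.linear sA sM (\<lambda>x. F (merge mul i (xs[j := x])))"
    by cases (use i j len lin ends in \<open>simp_all add: merge_update\<close>)
qed

lemma multilinear_expand:
  assumes F: "multilinear sA sM (Suc n) F" and k: "k < n"
  shows "multilinear sA sM n (\<lambda>xs. F (expand mul k u v xs))"
  unfolding multilinear_def
proof (intro allI impI)
  fix xs :: "'a list" and j
  assume len: "length xs = n" and j: "j < n"
  let ?ys = "expand mul k u v xs"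
  have lin: "Vector_Spaces.linear sA sM (\<lambda>x. F (?ys[l := x]))" if "l \<le> n" for l
    using F that len k by (auto simp: multilinear_def)
  have at_k: "Vector_Spaces.linear sA sM (\<lambda>x. F (?ys[k := mul x u]))"
    using Vector_Spaces.linear_compose[OF linear_mul_left lin[of k]] k by (simp add: o_def)
  consider "j < k" | "j = k" | "k < j" by linarith
  then show "Vector_Spaces.linear sA sM (\<lambda>x. F (expand mul k u v (xs[j := x])))"
    by cases (use k j len lin at_k in \<open>simp_all add: expand_update\<close>)
qed

lemma multilinear_lm:
  assumes F: "multilinear sA sM n F"
  shows "multilinear sA sM (Suc n) (\<lambda>xs. lm (hd xs) (F (tl xs)))"
  unfolding multilinear_def
proof (intro allI impI)
  fix xs :: "'a list" and j
  assume len: "length xs = Suc n" and j: "j < Suc n"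
  then obtain a ys where xs: "xs = a # ys" "length ys = n"
    by (cases xs) auto
  show "Vector_Spaces.linear sA sM (\<lambda>x. lm (hd (xs[j := x])) (F (tl (xs[j := x]))))"
  proof (cases j)
    case 0
    then show ?thesis by (simp add: xs linear_lm_left)
  next
    case (Suc l)
    then have "Vector_Spaces.linear sA sM (\<lambda>x. F (ys[l := x]))"
      using F j xs by (simp add: multilinear_def)
    from Vector_Spaces.linear_compose[OF this linear_lm_right] show ?thesis
      by (simp add: xs Suc o_def)
  qed
qed

lemma multilinear_rm:
  assumes F: "multilinear sA sM n F"
  shows "multilinear sA sM (Suc n) (\<lambda>xs. rm (F (butlast xs)) (last xs))"
  unfolding multilinear_def
proof (intro allI impI)
  fix xs :: "'a list" and j
  assume len: "length xs = Suc n" and j: "j < Suc n"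
  then obtain a ys where xs: "xs = ys @ [a]" "length ys = n"
    by (cases xs rule: rev_cases) auto
  show "Vector_Spaces.linear sA sM (\<lambda>x. rm (F (butlast (xs[j := x]))) (last (xs[j := x])))"
  proof (cases "j = n")
    case True
    then show ?thesis by (simp add: xs list_update_append linear_rm_right)
  next
    case False
    then have "Vector_Spaces.linear sA sM (\<lambda>x. F (ys[j := x]))"
      using F j xs by (simp add: multilinear_def)
    from Vector_Spaces.linear_compose[OF this linear_rm_left] show ?thesis
      using False j by (simp add: xs list_update_append o_def)
  qed
qed

lemma multilinear_add:
  "multilinear sA sM n F \<Longrightarrow> multilinear sA sM n G \<Longrightarrow> multilinear sA sM n (\<lambda>xs. F xs + G xs)"
  by (auto simp: multilinear_def intro: AM.linear_compose_add)

lemma multilinear_scale: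
  "multilinear sA sM n F \<Longrightarrow> multilinear sA sM n (\<lambda>xs. sM c (F xs))"
  by (auto simp: multilinear_def intro: AM.linear_compose_scale_right)

lemma multilinear_sum:
  "(\<And>i. i \<in> I \<Longrightarrow> multilinear sA sM n (F i)) \<Longrightarrow> multilinear sA sM n (\<lambda>xs. \<Sum>i\<in>I. F i xs)"
  by (auto simp: multilinear_def intro: AM.linear_compose_sum)

lemma multilinear_cong:
  assumes "multilinear sA sM n F" "\<And>xs. length xs = n \<Longrightarrow> G xs = F xs"
  shows "multilinear sA sM n G"
  using assms by (simp add: multilinear_def)

lemma d_cochain:
  assumes "f \<in> C p"
  shows "d p f \<in> C (Suc p)"
proof -
  have "multilinear sA sM p f" using assms by (simp add: cochains_iff)
  then have "multilinear sA sM (Suc p) (\<lambda>xs.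
      lm (hd xs) (f (tl xs)) + (\<Sum>i<p. sM ((-1) ^ Suc i) (f (merge mul i xs)))
       + sM ((-1) ^ Suc p) (rm (f (butlast xs)) (last xs)))"
    by (intro multilinear_add multilinear_sum multilinear_scale multilinear_lm multilinear_rm
          multilinear_merge) auto
  then show ?thesis
    by (auto simp: cochains_iff d_eq elim: multilinear_cong)
qed

lemma d_add: "d p (f + g) = d p f + d p g"
  by (auto simp: d_eq fun_eq_iff lm_simps rm_simps M.scale_right_distrib sum.distrib
      simp del: power_Suc)

lemma d_scale: "d p (cochain_scale sM c f) = cochain_scale sM c (d p f)"
  by (auto simp: d_eq fun_eq_iff cochain_scale_def lm_simps rm_simps M.scale_right_distrib
      M.scale_sum_right mult.commute simp del: power_Suc)

lemma d_zero: "d p 0 = 0"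
  using d_add[of p 0 0] by simp

lemma subspace_cochains: "F.subspace (C p)"
  by (rule F.subspaceI)
    (auto simp: cochains_iff cochain_scale_def multilinear_def zero_fun_def plus_fun_def
      intro: AM.linear_zero AM.linear_compose_add AM.linear_compose_scale_right)

lemma subspace_cocycles: "F.subspace (Z p)"
  by (rule F.subspaceI)
    (auto simp: cocycles_def d_zero d_add d_scale subspace_cochains
      intro: F.subspace_0 F.subspace_add F.subspace_scale)

lemma subspace_coboundaries: "F.subspace (B p)"
proof (cases p)
  case 0
  then show ?thesis by (simp add: coboundaries_def)
next
  case (Suc q)
  show ?thesis
  proof (rule F.subspaceI)
    show "0 \<in> B p"
      using d_zero[of q] F.subspace_0[OF subspace_cochains]
      by (force simp: coboundaries_def Suc)
  next
    fix f g assume "f \<in> B p" "g \<in> B p"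
    then show "f + g \<in> B p"
      using F.subspace_add[OF subspace_cochains]
      by (auto simp: coboundaries_def Suc d_add[symmetric])
  next
    fix c f assume "f \<in> B p"
    then show "cochain_scale sM c f \<in> B p"
      using F.subspace_scale[OF subspace_cochains]
      by (auto simp: coboundaries_def Suc d_scale[symmetric])
  qed
qed

text \<open>The \<open>A\<close>-bilinear extension of a cochain to lists with two more entries. It turns the outer
  terms of the Hochschild differential into merges of neighbours like the inner ones.\<close>

definition bar :: "('a list \<Rightarrow> 'm) \<Rightarrow> 'a list \<Rightarrow> 'm" where
  "bar f xs = lm (hd xs) (rm (f (butlast (tl xs))) (last xs))"

text \<open>A list of length \<open>Suc n\<close> has exactly \<open>n\<close> faces, so the sum
  runs over all of them.\<close>

definition bar_d :: "nat \<Rightarrow> ('a list \<Rightarrow> 'm) \<Rightarrow> 'a list \<Rightarrow> 'm" where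
  "bar_d n F xs = (\<Sum>i<n. sM ((-1) ^ i) (F (merge mul i xs)))"

lemma bar_snoc [simp]: "bar f (a # xs @ [b]) = lm a (rm (f xs) b)"
  by (simp add: bar_def)

lemma list_ends:
  assumes "length xs = Suc (Suc n)"
  obtains a ys b where "xs = a # ys @ [b]" "length ys = n"
  using assms by (metis append_butlast_last_id length_Suc_conv length_butlast length_0_conv
      diff_Suc_1 list.distinct(1))

lemma merge_snoc: "Suc i < length xs \<Longrightarrow> merge m i (xs @ [b]) = merge m i xs @ [b]"
  by (simp add: merge_conv_take_drop nth_append)

lemma merge_append: "merge m (length xs) (xs @ a # b # ys) = xs @ m a b # ys"
  by (induction xs) auto

text \<open>Face 0 is the left action and face \<open>Suc p\<close> the right one, by
  multiplicativity of the actions. The inner faces are shifted by one, which accounts for the offset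
  of the signs.\<close>

lemma bar_hochschild_d:
  assumes "length xs = p + 3"
  shows "bar (d p f) xs = bar_d (p + 2) (bar f) xs"
proof -
  obtain a ys b where xs: "xs = a # ys @ [b]" and ys: "length ys = Suc p"
    using assms by (elim list_ends[of xs "Suc p", rotated]) simp_all
  obtain y ys' where y: "ys = y # ys'" "length ys' = p" using ys by (cases ys) auto
  obtain z ys'' where z: "ys = ys'' @ [z]" "length ys'' = p" using ys by (cases ys rule: rev_cases) auto
  have first: "bar f (merge mul 0 xs) = lm a (rm (lm (hd ys) (f (tl ys))) b)"
    using bar_snoc[of f "mul a y" ys' b] by (simp add: xs y lm_mul rm_lm)
  have "bar f (merge mul (Suc p) xs) = lm a (rm (f ys'') (mul z b))"
    using bar_snoc[of f a ys'' "mul z b"] merge_append[of mul ys'' z b "[]"]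
    by (simp add: xs z)
  then have last: "bar f (merge mul (Suc p) xs) = lm a (rm (rm (f (butlast ys)) (last ys)) b)"
    by (simp add: z rm_mul)
  have mid: "bar f (merge mul (Suc i) xs) = lm a (rm (f (merge mul i ys)) b)" if "i < p" for i
    using that ys bar_snoc[of f a "merge mul i ys" b] by (simp add: xs merge_snoc)
  have "bar_d (p + 2) (bar f) xs = bar f (merge mul 0 xs)
      + (\<Sum>i<p. sM ((-1) ^ Suc i) (bar f (merge mul (Suc i) xs)))
      + sM ((-1) ^ Suc p) (bar f (merge mul (Suc p) xs))"
    unfolding bar_d_def add_2_eq_Suc' sum.lessThan_Suc_shift[of _ "Suc p"] 
    by (simp add: add.assoc)
  also have "\<dots> = bar (d p f) xs"
    unfolding xs bar_snoc d_eq first[unfolded xs] last[unfolded xs] 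
    using mid ys by (simp add: xs lm_simps rm_simps del: power_Suc)
  finally show ?thesis by simp
qed

text \<open>The simplicial identity pairs the terms on the two sides of the diagonal, and paired
  terms have opposite signs.\<close>

lemma bar_d_bar_d:
  assumes "length xs = n + 2"
  shows "bar_d (Suc n) (bar_d n F) xs = 0"
proof -
  let ?t = "\<lambda>j i. sM ((-1) ^ (j + i)) (F (merge mul i (merge mul j xs)))"
  have "bar_d (Suc n) (bar_d n F) xs = (\<Sum>j<Suc n. \<Sum>i<n. ?t j i)"
    unfolding bar_d_def M.scale_sum_right by (simp add: power_add)
  also have "\<dots> = (\<Sum>j<n. \<Sum>i\<le>j. ?t (Suc j) i) + (\<Sum>j<n. \<Sum>i\<le>j. ?t i j)"
    by (rule sum_swap_upper_triangle)
  also have "\<dots> = (\<Sum>j<n. \<Sum>i\<le>j. ?t (Suc j) i + ?t i j)"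
    by (simp add: sum.distrib del: power_Suc)
  also have "\<dots> = 0"
  proof (intro sum.neutral ballI)
    fix i j assume "j \<in> {..<n}" "i \<in> {..j}"
    then have "merge mul i (merge mul (Suc j) xs) = merge mul j (merge mul i xs)"
      using assms by (intro merge_merge mul_assoc) auto
    then show "?t (Suc j) i + ?t i j = 0"
      by (simp add: add.commute)
  qed
  finally show ?thesis .
qed

lemma bar_d_cong:
  "(\<And>ys. length ys = n \<Longrightarrow> F ys = G ys) \<Longrightarrow> length xs = Suc n \<Longrightarrow> bar_d n F xs = bar_d n G xs"
  unfolding bar_d_def by (rule sum.cong) auto

text \<open>Nothing is lost by the bilinear extension: \<open>one\<close> in both outer slots
  recovers \<open>d p f\<close>.\<close>

lemma d_eq_zero_iff: "d p f = 0 \<longleftrightarrow> (\<forall>xs. length xs = p + 3 \<longrightarrow> bar_d (p + 2) (bar f) xs = 0)"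
proof
  assume "d p f = 0"
  then show "\<forall>xs. length xs = p + 3 \<longrightarrow> bar_d (p + 2) (bar f) xs = 0"
    by (simp add: bar_hochschild_d[symmetric] bar_def lm_simps rm_simps del: add_2_eq_Suc')
next
  assume *: "\<forall>xs. length xs = p + 3 \<longrightarrow> bar_d (p + 2) (bar f) xs = 0"
  have "d p f xs = 0" for xs
  proof (cases "length xs = Suc p")
    case True
    then have "bar (d p f) (one # xs @ [one]) = 0"
      using * by (simp add: bar_hochschild_d del: bar_snoc)
    then show ?thesis by simp
  qed (simp add: d_eq)
  then show "d p f = 0" by auto
qed

lemma d_d: "d (Suc p) (d p f) = 0"
proof -
  have "bar_d (Suc p + 2) (bar (d p f)) xs = bar_d (Suc p + 2) (bar_d (p + 2) (bar f)) xs"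
    if "length xs = Suc p + 3" for xs
    using that by (intro bar_d_cong bar_hochschild_d) auto
  then show ?thesis
    using bar_d_bar_d[of _ "p + 2"] by (simp add: d_eq_zero_iff)
qed

lemma coboundaries_subset_cocycles: "B p \<subseteq> Z p"
proof (cases p)
  case 0
  then show ?thesis
    using F.subspace_0[OF subspace_cocycles] by (simp add: coboundaries_def)
next
  case (Suc q)
  then show ?thesis by (auto simp: coboundaries_def cocycles_def d_d d_cochain)
qed

end

section \<open>Cocycles relative to a finite group of units\<close>

text \<open>The normalisation is carried out for any algebra with a homomorphism from a finite group
  to its units; in the application the coefficients are the skew group algebra itself.\<close>

locale algebra_bimodule_units = algebra_bimodule sA sM mul one lm rm
  for sA :: "complex \<Rightarrow> 'a::ab_group_add \<Rightarrow> 'a" and sM :: "complex \<Rightarrow> 'm::ab_group_add \<Rightarrow> 'm"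
    and mul one lm rm +
  fixes \<gamma> :: "'g::{group_add,finite} \<Rightarrow> 'a"
  assumes \<gamma>_zero [simp]: "\<gamma> 0 = one"
    and \<gamma>_add: "\<gamma> (g + h) = mul (\<gamma> g) (\<gamma> h)"
begin

text \<open>In these notions the outermost entries of a list are the bimodule slots of \<open>bar\<close>, so the
  arguments of the cochain have positions \<open>1, \<dots>, p\<close>.\<close>

definition vanishes :: "nat \<Rightarrow> nat \<Rightarrow> ('a list \<Rightarrow> 'm) \<Rightarrow> bool" where
  "vanishes n k F \<longleftrightarrow>
     (\<forall>xs j g. length xs = n \<longrightarrow> 0 < j \<longrightarrow> j \<le> k \<longrightarrow> xs ! j = \<gamma> g \<longrightarrow> F xs = 0)"

definition relative :: "nat \<Rightarrow> ('a list \<Rightarrow> 'm) \<Rightarrow> bool" where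
  "relative p F \<longleftrightarrow> (\<forall>xs a g b ys. length xs + length ys = p \<longrightarrow>
     F (xs @ mul a (\<gamma> g) # b # ys) = F (xs @ a # mul (\<gamma> g) b # ys))"

definition average :: "nat \<Rightarrow> ('a list \<Rightarrow> 'm) \<Rightarrow> 'a list \<Rightarrow> 'm" where
  "average k F xs = sM ((-1) ^ k / of_nat (card (UNIV :: 'g set)))
     (\<Sum>g\<in>UNIV. F (expand mul k (\<gamma> g) (\<gamma> (- g)) xs))"

lemma vanishesD:
  "vanishes n k F \<Longrightarrow> length xs = n \<Longrightarrow> 0 < j \<Longrightarrow> j \<le> k \<Longrightarrow> xs ! j = \<gamma> g \<Longrightarrow> F xs = 0"
  unfolding vanishes_def by blast

lemma \<gamma>_inverse [simp]: "mul (\<gamma> g) (\<gamma> (- g)) = one" "mul (\<gamma> (- g)) (\<gamma> g) = one"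
  by (simp_all flip: \<gamma>_add)

text \<open>Every face that does not touch the group entry leaves it at a place from 1 to
  \<open>k\<close>, where \<open>F\<close> vanishes. The alternative \<open>l = k\<close> is the
  last argument: no face lies to the right of the two that touch it.\<close>

lemma bar_d_unit:
  assumes F: "vanishes n k F" and len: "length xs = Suc n" and xs: "xs ! Suc l = \<gamma> h"
    and l: "l < k \<or> (l = k \<and> n = k + 2)" and k: "k + 2 \<le> n"
  shows "bar_d n F xs = sM ((-1) ^ l) (F (merge mul l xs) - F (merge mul (Suc l) xs))"
proof -
  have "F (merge mul i xs) = 0" if "i < n" "i \<noteq> l" "i \<noteq> Suc l" for i
  proof (cases "i < l")
    case True
    then show ?thesis
      using that len xs l k by (intro vanishesD[OF F, of _ l h]) (auto simp: nth_merge)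
  next
    case False
    then show ?thesis
      using that len xs l k by (intro vanishesD[OF F, of _ "Suc l" h]) (auto simp: nth_merge)
  qed
  then have "bar_d n F xs = (\<Sum>i\<in>{l, Suc l}. sM ((-1) ^ i) (F (merge mul i xs)))"
    unfolding bar_d_def using l k by (intro sum.mono_neutral_right) auto
  then show ?thesis
    by (simp add: M.scale_right_diff_distrib)
qed

lemma merge_unit_eq:
  assumes "vanishes n k F" "length xs = Suc n" "xs ! Suc l = \<gamma> h"
    "l < k \<or> (l = k \<and> n = k + 2)" "k + 2 \<le> n" "bar_d n F xs = 0"
  shows "F (merge mul l xs) = F (merge mul (Suc l) xs)"
  using bar_d_unit[OF assms(1-5)] assms(6) by simp

section \<open>The average as a partial homotopy\<close>

text \<open>The insertion leaves the places before \<open>k\<close> alone and multiplies the entry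
  at place \<open>k\<close> by a group element, so a group entry remains one.\<close>

lemma vanishes_average:
  assumes F: "vanishes (Suc m) k F" and k: "k < m"
  shows "vanishes m k (average k F)"
  unfolding vanishes_def
proof (intro allI impI)
  fix xs :: "'a list" and j h
  assume len: "length xs = m" and j: "0 < j" "j \<le> k" "xs ! j = \<gamma> h"
  have "F (expand mul k (\<gamma> g) (\<gamma> (- g)) xs) = 0" for g
    using len k j
    by (intro vanishesD[OF F, of _ j "if j = k then h + g else h"]) (auto simp: nth_expand \<gamma>_add)
  then show "average k F xs = 0"
    by (simp add: average_def)
qed

text \<open>Only two faces remain, and they agree because the group entry can be moved across the
  tensor sign in every summand.\<close>

lemma bar_d_average_low:
  assumes F: "vanishes (Suc m) k F" and k: "k + 2 \<le> m"
    and cocycle: "\<And>xs. length xs = Suc (Suc m) \<Longrightarrow> bar_d (Suc m) F xs = 0"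
    and len: "length xs = Suc m" and l: "l < k" "xs ! Suc l = \<gamma> h"
  shows "bar_d m (average k F) xs = 0"
proof -
  have "F (expand mul k (\<gamma> g) (\<gamma> (- g)) (merge mul l xs))
      = F (expand mul k (\<gamma> g) (\<gamma> (- g)) (merge mul (Suc l) xs))" for g
  proof -
    \<comment> \<open>The insertion is made at \<open>Suc k\<close> because a face to its left
      lowers its place to \<open>k\<close>.\<close>
    let ?zs = "expand mul (Suc k) (\<gamma> g) (\<gamma> (- g)) xs"
    have "F (merge mul l ?zs) = F (merge mul (Suc l) ?zs)"
      using assms by (intro merge_unit_eq[OF F, of _ _ h]) (auto simp: nth_expand)
    then show ?thesis
      using l k len by (simp add: merge_expand_less mul_assoc)
  qed
  then have "average k F (merge mul l xs) = average k F (merge mul (Suc l) xs)"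
    by (simp add: average_def)
  then show ?thesis
    using bar_d_unit[of m k "average k F" xs l h] vanishes_average[OF F] k len l by simp
qed

text \<open>The homotopy formula: in the cocycle identity for the lengthened list, face
  \<open>k\<close> gives back \<open>xs\<close>, and the later faces sum up to the boundary of the
  average.\<close>

lemma bar_d_average_top:
  assumes F: "vanishes (Suc m) k F" and k: "k + 2 \<le> m"
    and cocycle: "\<And>xs. length xs = Suc (Suc m) \<Longrightarrow> bar_d (Suc m) F xs = 0"
    and len: "length xs = Suc m" and xs: "xs ! Suc k = \<gamma> h"
  shows "bar_d m (average k F) xs = F xs"
proof -
  let ?e = "\<lambda>g. expand mul k (\<gamma> g) (\<gamma> (- g))"
  let ?N = "of_nat (card (UNIV :: 'g set)) :: complex"
  have low: "average k F (merge mul i xs) = 0" if "i < k" for i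
    using that k len xs
    by (intro vanishesD[OF vanishes_average[OF F], of _ k h]) (auto simp: nth_merge)
  \<comment> \<open>With \<open>h + g\<close> in place of \<open>g\<close>, the inserted inverse
    times \<open>\<gamma> h\<close> is \<open>\<gamma> (- g)\<close>, and the entry before it is x_k
    h g on both sides.\<close>
  have at_k: "(\<Sum>g\<in>UNIV. F (?e g (merge mul k xs))) = (\<Sum>g\<in>UNIV. F (merge mul (Suc k) (?e g xs)))"
  proof (rule sum.reindex_bij_witness[of _ "\<lambda>g. - h + g" "\<lambda>g. h + g"])
    fix g
    have "merge mul (Suc k) (?e (h + g) xs) = ?e g (merge mul k xs)"
      by (rule nth_equalityI)
        (use k len xs in \<open>auto simp: nth_merge nth_expand \<gamma>_add mul_assoc minus_add simp flip: \<gamma>_add\<close>)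
    then show "F (merge mul (Suc k) (?e (h + g) xs)) = F (?e g (merge mul k xs))" by simp
  qed (auto simp: add.assoc[symmetric])
  have high: "(\<Sum>g\<in>UNIV. F (?e g (merge mul i xs))) = (\<Sum>g\<in>UNIV. F (merge mul (Suc i) (?e g xs)))"
    if "k \<le> i" "i < m" for i
    using that at_k len by (cases "i = k") (auto simp: merge_expand_greater)
  \<comment> \<open>This is the cocycle identity for the lengthened list: the faces before
    \<open>k\<close> move \<open>\<gamma> (- g)\<close> to place \<open>k\<close> and vanish, and
    face \<open>k\<close> cancels the inserted pair.\<close>
  have cancel: "(\<Sum>i\<in>{k..<m}. sM ((-1) ^ i) (F (merge mul (Suc i) (?e g xs)))) = sM ((-1) ^ k) (F xs)" for g
  proof -
    let ?t = "\<lambda>i. sM ((-1) ^ i) (F (merge mul i (?e g xs)))"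
    have "F (merge mul i (?e g xs)) = 0" if "i < k" for i
      using that k len by (intro vanishesD[OF F, of _ k "- g"]) (auto simp: nth_merge nth_expand)
    then have "(\<Sum>i<Suc m. ?t i) = (\<Sum>i\<in>{k..<Suc m}. ?t i)"
      by (intro sum.mono_neutral_right) auto
    then have "0 = (\<Sum>i\<in>{k..<Suc m}. ?t i)"
      using cocycle[of "?e g xs"] len k by (simp add: bar_d_def)
    also have "\<dots> = ?t k + (\<Sum>i\<in>{k..<m}. ?t (Suc i))"
      using k by (simp add: sum.atLeast_Suc_lessThan sum.atLeast_Suc_lessThan_Suc_shift
          del: power_Suc sum.op_ivl_Suc)
    also have "(\<Sum>i\<in>{k..<m}. ?t (Suc i))
        = - (\<Sum>i\<in>{k..<m}. sM ((-1) ^ i) (F (merge mul (Suc i) (?e g xs))))"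
      by (simp add: sum_negf)
    also have "merge mul k (?e g xs) = xs"
      by (rule nth_equalityI) (use k len in \<open>auto simp: nth_merge nth_expand mul_assoc\<close>)
    finally show ?thesis by simp
  qed
  have "bar_d m (average k F) xs = (\<Sum>i\<in>{k..<m}. sM ((-1) ^ i) (average k F (merge mul i xs)))"
    unfolding bar_d_def using low k by (intro sum.mono_neutral_right) auto
  also have "\<dots> = (\<Sum>i\<in>{k..<m}. sM ((-1) ^ k / ?N)
      (\<Sum>g\<in>UNIV. sM ((-1) ^ i) (F (merge mul (Suc i) (?e g xs)))))"
    by (rule sum.cong) (auto simp: average_def high M.scale_sum_right mult.commute)
  also have "\<dots> = sM ((-1) ^ k / ?N)
      (\<Sum>g\<in>UNIV. \<Sum>i\<in>{k..<m}. sM ((-1) ^ i) (F (merge mul (Suc i) (?e g xs))))"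
    by (subst sum.swap) (simp only: M.scale_sum_right)
  \<comment> \<open>Each group element contributes the same value, which explains the prefactor in
    \<open>average\<close>.\<close>
  also have "\<dots> = sM ((-1) ^ k / ?N) (\<Sum>g\<in>(UNIV :: 'g set). sM ((-1) ^ k) (F xs))"
    by (simp only: cancel)
  also have "\<dots> = F xs"
    by (simp add: M.sum_constant_scale mult.assoc[symmetric] power_add[symmetric])
  finally show ?thesis .
qed

text \<open>A coboundary needs an actual cochain. The average is bilinear in the outer slots, so it
  is the extension of its values with \<open>one\<close> in both.\<close>

lemma bar_average:
  assumes f: "f \<in> C (Suc q)" and k: "k \<le> q"
  obtains u where "u \<in> C q" "\<And>xs. length xs = q + 2 \<Longrightarrow> bar u xs = average k (bar f) xs"
proof
  let ?U = "average k (bar f)"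
  define u where "u ys = (if length ys = q then ?U (one # ys @ [one]) else 0)" for ys
  have "multilinear sA sM (Suc (Suc (Suc q))) (\<lambda>xs. lm (hd xs) (rm (f (butlast (tl xs))) (last (tl xs))))"
    using f multilinear_lm[OF multilinear_rm, of "Suc q" f] by (simp add: cochains_iff)
  then have "multilinear sA sM (q + 3) (bar f)"
    unfolding bar_def numeral_3_eq_3 add_Suc_right add_0_right
    by (rule multilinear_cong) (metis last_tl list.size(3) length_tl diff_Suc_1 old.nat.distinct(2))
  then have U: "multilinear sA sM (q + 2) ?U"
    unfolding average_def using k
    by (intro multilinear_scale multilinear_sum multilinear_expand) (auto simp: numeral_3_eq_3)
  have "Vector_Spaces.linear sA sM (\<lambda>x. u (ys[i := x]))" if "length ys = q" "i < q" for ys i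
  proof -
    have "u (ys[i := x]) = ?U ((one # ys @ [one])[Suc i := x])" for x
      using that by (simp add: u_def list_update_append)
    moreover have "Vector_Spaces.linear sA sM (\<lambda>x. ?U ((one # ys @ [one])[Suc i := x]))"
      using U[unfolded multilinear_def, rule_format, of "one # ys @ [one]" "Suc i"] that by simp
    ultimately show ?thesis by simp
  qed
  then show "u \<in> C q"
    by (auto simp: cochains_iff multilinear_def u_def)
  fix xs :: "'a list"
  assume "length xs = q + 2"
  then obtain a ys b where xs: "xs = a # ys @ [b]" "length ys = q"
    by (elim list_ends[of xs q, rotated]) simp_all
  have "bar f (expand mul k v w (a # ys @ [b])) = lm a (rm (bar f (expand mul k v w (one # ys @ [one]))) b)"
    for v w
  \<comment> \<open>For \<open>k = 0\<close> the insertion multiplies the left bimodule slot by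
    \<open>v\<close>, which \<open>lm_mul\<close> absorbs; otherwise both outer slots stay
    untouched.\<close>
  proof (cases k)
    case 0
    then show ?thesis
      using bar_snoc[of f "mul a v" "w # ys" b] bar_snoc[of f v "w # ys" one]
      by (simp add: lm_mul rm_lm)
  next
    case (Suc l)
    have "expand mul l v w (ys @ [b]) = expand mul l v w ys @ [b]" for b
    proof -
      have "l < length ys" using Suc k xs by simp
      then show ?thesis
        by (induction mul l v w ys rule: expand.induct) auto
    qed
    then show ?thesis by (simp add: Suc)
  qed
  then show "bar u xs = ?U xs"
    using xs by (simp add: u_def average_def lm_simps rm_simps)
qed

section \<open>Normalisation of cocycles\<close>

lemma normalize_cocycle:
  assumes f: "f \<in> Z p" and "k \<le> p"
  shows "\<exists>f'\<in>Z p. f - f' \<in> B p \<and> vanishes (p + 2) k (bar f')"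
  using \<open>k \<le> p\<close>
proof (induction k)
  case 0
  then show ?case
  proof (intro bexI conjI)
    show "f - f \<in> B p"
      using F.subspace_0[OF subspace_coboundaries] by (simp only: diff_self)
  qed (use f in \<open>auto simp: vanishes_def\<close>)
next
  case (Suc k)
  then obtain f' where f': "f' \<in> Z p" "f - f' \<in> B p" and van: "vanishes (p + 2) k (bar f')"
    using Suc_leD by blast
  \<comment> \<open>A further place to treat exists, so \<open>p\<close> is positive and the
    correcting cochain lives one degree lower.\<close>
  obtain q where p: "p = Suc q" using Suc.prems by (cases p) auto
  have cocycle: "bar_d (p + 2) (bar f') xs = 0" if "length xs = p + 3" for xs
    using f' that d_eq_zero_iff[of p f'] by (auto simp: cocycles_def)
  obtain u where u: "u \<in> C q" and bar_u: "\<And>xs. length xs = q + 2 \<Longrightarrow> bar u xs = average k (bar f') xs"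
    using bar_average[of f' q k] f' Suc.prems by (auto simp: cocycles_def p)
  have du: "d q u \<in> B p" using u by (simp add: coboundaries_def p)
  have "bar (f' - d q u) xs = 0"
    if len: "length xs = p + 2" and j: "0 < j" "j \<le> Suc k" "xs ! j = \<gamma> h" for xs j h
  proof -
    have "bar (d q u) xs = bar_d (q + 2) (average k (bar f')) xs"
      using len by (simp add: p bar_hochschild_d bar_u cong: bar_d_cong)
    \<comment> \<open>At the new place the coboundary reproduces \<open>f'\<close>; at the earlier
      places both vanish, so what has been achieved is kept.\<close>
    also have "\<dots> = bar f' xs"
    proof (cases "j = Suc k")
      case True
      then show ?thesis
        using bar_d_average_top[of "q + 2" k "bar f'" xs h] van cocycle len j Suc.prems by (simp add: p)
    next
      case False
      then have "bar f' xs = 0"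
        using j len by (intro vanishesD[OF van, of _ j h]) auto
      then show ?thesis
        using bar_d_average_low[of "q + 2" k "bar f'" xs "j - 1" h] van cocycle len j Suc.prems False
        by (simp add: p)
    qed
    moreover have "bar (f' - d q u) xs = bar f' xs - bar (d q u) xs"
      by (simp add: bar_def lm_hom[THEN module_hom.diff] rm_hom[THEN module_hom.diff])
    ultimately show ?thesis by simp
  qed
  moreover have "f' - d q u \<in> Z p"
    using f' du coboundaries_subset_cocycles by (auto intro: F.subspace_diff[OF subspace_cocycles])
  moreover have "f - (f' - d q u) \<in> B p"
    using F.subspace_add[OF subspace_coboundaries f'(2) du] by (simp add: algebra_simps)
  ultimately show ?case
    unfolding vanishes_def by blast
qed

text \<open>Together with multilinearity, \<open>relative\<close> says that the extension descends
  to tensor products over the group algebra. For a cocycle vanishing on group entries, the identity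
  on a list with \<open>\<gamma> g\<close> between \<open>a\<close> and \<open>b\<close> has just
  two terms left, and these give the balancing.\<close>

theorem cohomologous_relative_cocycle:
  assumes "f \<in> Z p"
  obtains f' where "f' \<in> Z p" "f - f' \<in> B p" "relative p (bar f')"
proof -
  obtain f' where f': "f' \<in> Z p" "f - f' \<in> B p" and van: "vanishes (p + 2) p (bar f')"
    using normalize_cocycle[OF assms order_refl] by auto
  have cocycle: "bar_d (p + 2) (bar f') xs = 0" if "length xs = p + 3" for xs
    using f' that d_eq_zero_iff[of p f'] by (auto simp: cocycles_def)
  have "relative p (bar f')"
    unfolding relative_def
  proof (intro allI impI)
    fix xs ys :: "'a list" and a b g
    assume len: "length xs + length ys = p"
    let ?zs = "xs @ a # \<gamma> g # b # ys"
    have "bar f' (merge mul (length xs) ?zs) = bar f' (merge mul (Suc (length xs)) ?zs)"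
      using len by (intro merge_unit_eq[OF van _ _ _ _ cocycle]) (auto simp: nth_append)
    then show "bar f' (xs @ mul a (\<gamma> g) # b # ys) = bar f' (xs @ a # mul (\<gamma> g) b # ys)"
      using merge_append[of mul "xs @ [a]" "\<gamma> g" b ys] by (simp add: merge_append)
  qed
  with f' show ?thesis by (rule that)
qed

end

section \<open>The skew group algebra\<close>

lemma sum_fun_apply: "(\<Sum>i\<in>I. f i) x = (\<Sum>i\<in>I. f i x)"
  by (induction I rule: infinite_finite_induct) auto

lemma finite_lists_of_length: "finite {xs :: 'g::finite list. length xs = n}"
  using finite_lists_length_eq[OF finite[of "UNIV :: 'g set"]] by simp

lemma skew_embed_apply: "skew_embed s g = (if g = 0 then s else 0)"
  by (simp add: skew_embed_def skew_elem_def)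

lemma length_twist [simp]: "length (twist act fs gs) = length fs"
  by (simp add: twist_def)

lemma nth_twist: "i < length fs \<Longrightarrow> twist act fs gs ! i = act (sum_list (take i gs)) (fs ! i)"
  by (simp add: twist_def)

lemma twist_update:
  "i < length fs \<Longrightarrow>
    twist act (fs[i := x]) gs = (twist act fs gs)[i := act (sum_list (take i gs)) x]"
  by (rule nth_equalityI) (auto simp: nth_twist nth_list_update)

context algebra_bimodule
begin

lemma cochain_zero_arg:
  assumes "f \<in> C p" "i < length xs" "xs ! i = 0"
  shows "f xs = 0"
proof (cases "length xs = p")
  case True
  with assms have "Vector_Spaces.linear sA sM (\<lambda>x. f (xs[i := x]))"
    by (simp add: cochains_iff multilinear_def)
  then have "f (xs[i := 0]) = 0"
    unfolding Vector_Spaces.linear_iff_module_hom by (rule module_hom.zero)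
  then show ?thesis using assms by (metis list_update_id)
qed (use assms in \<open>simp add: cochains_iff\<close>)

lemma cochain_length: "f \<in> C p \<Longrightarrow> length xs \<noteq> p \<Longrightarrow> f xs = 0"
  by (simp add: cochains_iff)

end

section \<open>The skew group algebra and its bimodules\<close>

context finite_group_action
begin

abbreviation "sk \<equiv> skew_scale scale"
abbreviation "mult \<equiv> skew_mult act"
abbreviation "grp \<equiv> skew_elem 1"

lemmas act_hom = act_linear[unfolded Vector_Spaces.linear_iff_module_hom]
lemmas act_add_right = act_hom[THEN module_hom.add]
lemmas act_scale = act_hom[THEN module_hom.scale]
lemmas act_sum = act_hom[THEN module_hom.sum]
lemmas act_zero_right [simp] = act_hom[THEN module_hom.zero]
declare act_zero [simp] act_one [simp]

lemma vector_space_skew: "vector_space (sk :: complex \<Rightarrow> ('g \<Rightarrow> 's) \<Rightarrow> 'g \<Rightarrow> 's)"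
  by unfold_locales
    (auto simp: skew_scale_def fun_eq_iff scale_right_distrib scale_left_distrib)

lemma linear_skew_mult_left: "Vector_Spaces.linear sk sk (\<lambda>a. mult a b)"
  by (auto simp: Vector_Spaces.linear_iff vector_space_skew skew_mult_def skew_scale_def fun_eq_iff
      distrib_right sum.distrib scale_mult_left scale_sum_right)

lemma linear_skew_mult_right: "Vector_Spaces.linear sk sk (mult a)"
  by (auto simp: Vector_Spaces.linear_iff vector_space_skew skew_mult_def skew_scale_def fun_eq_iff
      distrib_left act_add_right act_scale sum.distrib scale_mult_right scale_sum_right)

lemma skew_mult_assoc: "mult (mult a b) c = mult a (mult b c)"
proof
  fix k
  have "mult (mult a b) c k = (\<Sum>h\<in>UNIV. \<Sum>g\<in>UNIV. a g * act g (b (- g + h)) * act h (c (- h + k)))"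
    by (simp add: skew_mult_def sum_distrib_right)
  also have "\<dots> = (\<Sum>g\<in>UNIV. \<Sum>h\<in>UNIV. a g * act g (b (- g + h)) * act h (c (- h + k)))"
    by (rule sum.swap)
  also have "\<dots> = (\<Sum>g\<in>UNIV. \<Sum>h\<in>UNIV. a g * act g (b h) * act (g + h) (c (- (g + h) + k)))"
  proof (rule sum.cong[OF refl])
    fix g
    show "(\<Sum>h\<in>UNIV. a g * act g (b (- g + h)) * act h (c (- h + k)))
        = (\<Sum>h\<in>UNIV. a g * act g (b h) * act (g + h) (c (- (g + h) + k)))"
      by (rule sum.reindex_bij_witness[of _ "\<lambda>h. g + h" "\<lambda>h. - g + h"]) simp_all
  qed
  also have "\<dots> = mult a (mult b c) k"
  proof -
    have "- (g + h) + k = - h + (- g + k)" for g h :: 'g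
      by (simp only: minus_add add.assoc)
    then show ?thesis
      by (simp only: skew_mult_def sum_distrib_left act_sum act_mult act_add mult.assoc)
  qed
  finally show "mult (mult a b) c k = mult a (mult b c) k" .
qed

lemma skew_mult_embed_left: "mult (skew_embed s) a = (\<lambda>k. s * a k)"
proof
  fix k
  have "mult (skew_embed s) a k = (\<Sum>g\<in>(UNIV :: 'g set). if g = 0 then s * a k else 0)"
    unfolding skew_mult_def by (rule sum.cong) (auto simp: skew_embed_apply)
  then show "mult (skew_embed s) a k = s * a k" by simp
qed

lemma skew_mult_one_right: "mult a (skew_embed 1) = a"
proof
  fix k
  have "- g + k = 0 \<longleftrightarrow> g = k" for g :: 'g
    using add_left_cancel[of g "- g + k" 0] by auto
  then have "mult a (skew_embed 1) k = (\<Sum>g\<in>(UNIV :: 'g set). if g = k then a k else 0)"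
    unfolding skew_mult_def by (intro sum.cong) (simp_all add: skew_embed_apply)
  then show "mult a (skew_embed 1) k = a k" by simp
qed

lemma skew_embed_mult: "skew_embed (r * s) = mult (skew_embed r) (skew_embed s)"
  by (simp add: skew_embed_def skew_mult_skew_elem)

lemma linear_skew_embed: "Vector_Spaces.linear scale sk (skew_embed :: 's \<Rightarrow> 'g \<Rightarrow> 's)"
  by (auto simp: Vector_Spaces.linear_iff vector_space_skew vector_space_axioms skew_embed_apply
      skew_scale_def fun_eq_iff)

lemma grp_zero: "grp 0 = skew_embed 1"
  by (simp add: skew_embed_def)

sublocale AA: algebra_bimodule_units "sk :: complex \<Rightarrow> ('g \<Rightarrow> 's) \<Rightarrow> 'g \<Rightarrow> 's" sk mult "skew_embed 1" mult mult grp
proof (intro algebra_bimodule_units.intro algebra_bimodule.intro vector_space_skew)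
  show "algebra_bimodule_axioms sk sk mult (skew_embed 1) mult mult"
    by (rule algebra_bimodule_axioms.intro)
      (auto simp: linear_skew_mult_left linear_skew_mult_right skew_mult_assoc
        skew_mult_embed_left skew_mult_one_right)
  show "algebra_bimodule_units_axioms mult (skew_embed 1) grp"
    by unfold_locales (auto simp: grp_zero skew_mult_skew_elem)
qed

sublocale SA: algebra_bimodule scale "sk :: complex \<Rightarrow> ('g \<Rightarrow> 's) \<Rightarrow> 'g \<Rightarrow> 's" "(*)" 1
  "\<lambda>s. mult (skew_embed s)" "\<lambda>a s. mult a (skew_embed s)"
proof (intro algebra_bimodule.intro vector_space_skew vector_space_axioms)
  have "Vector_Spaces.linear scale scale (\<lambda>x. x * y)" "Vector_Spaces.linear scale scale ((*) y)" for y
    by (auto simp: Vector_Spaces.linear_iff vector_space_axioms distrib_left distrib_right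
        scale_mult_left scale_mult_right)
  moreover have "Vector_Spaces.linear scale sk (\<lambda>s. mult (skew_embed s) a)"
    "Vector_Spaces.linear scale sk (\<lambda>s. mult a (skew_embed s))" for a :: "'g \<Rightarrow> 's"
    using Vector_Spaces.linear_compose[OF linear_skew_embed linear_skew_mult_left]
      Vector_Spaces.linear_compose[OF linear_skew_embed linear_skew_mult_right]
    by (simp_all add: o_def)
  ultimately show "algebra_bimodule_axioms scale sk (*) 1 (\<lambda>s. mult (skew_embed s)) (\<lambda>a s. mult a (skew_embed s))"
    by - (rule algebra_bimodule_axioms.intro,
      auto simp: linear_skew_mult_left linear_skew_mult_right skew_mult_assoc mult.assoc
        skew_embed_mult)
qed

lemmas skew_mult_left_hom = linear_skew_mult_left[unfolded Vector_Spaces.linear_iff_module_hom]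

lemma skew_elem_eq: "skew_elem s g = mult (skew_embed s) (grp g)"
  by (simp add: skew_embed_def skew_mult_skew_elem)

lemma grp_mult_embed: "mult (grp g) (skew_embed s) = mult (skew_embed (act g s)) (grp g)"
  by (simp add: skew_embed_def skew_mult_skew_elem)

lemma skew_conj_mult: "skew_conj act g (mult a b) = mult (skew_conj act g a) (skew_conj act g b)"
proof -
  have "mult (skew_conj act g a) (skew_conj act g b)
      = mult (grp g) (mult a (mult (mult (grp (- g)) (grp g)) (mult b (grp (- g)))))"
    by (simp only: skew_conj_def skew_mult_assoc)
  then show ?thesis by (simp add: skew_conj_def skew_mult_assoc)
qed

lemma skew_conj_embed: "skew_conj act g (skew_embed s) = skew_embed (act g s)"
  by (simp add: skew_conj_def grp_mult_embed skew_mult_assoc)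

lemma skew_conj_add: "skew_conj act (g + h) a = skew_conj act g (skew_conj act h a)"
  by (simp only: skew_conj_def AA.\<gamma>_add minus_add skew_mult_assoc)

lemma linear_skew_conj: "Vector_Spaces.linear sk sk (skew_conj act g)"
  using Vector_Spaces.linear_compose[OF linear_skew_mult_right linear_skew_mult_left]
  by (simp add: skew_conj_def[abs_def] o_def)

lemmas skew_conj_hom = linear_skew_conj[unfolded Vector_Spaces.linear_iff_module_hom]
lemmas skew_conj_simps = skew_conj_hom[THEN module_hom.add] skew_conj_hom[THEN module_hom.scale]
  skew_conj_hom[THEN module_hom.sum] skew_conj_hom[THEN module_hom.zero]

text \<open>A form of conjugation without inverses, suited to pushing group elements through
  products.\<close>

lemma skew_conj_eq_iff: "skew_conj act g a = b \<longleftrightarrow> mult (grp g) a = mult b (grp g)"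
proof
  assume "skew_conj act g a = b"
  then show "mult (grp g) a = mult b (grp g)"
    by (auto simp: skew_conj_def skew_mult_assoc)
next
  assume "mult (grp g) a = mult b (grp g)"
  then show "skew_conj act g a = b"
    by (simp add: skew_conj_def skew_mult_assoc)
qed

section \<open>Twisted argument lists and pure tensors\<close>

lemma twist_Cons: "twist act (f # fs) (g # gs) = f # map (act g) (twist act fs gs)"
  by (rule nth_equalityI) (auto simp: nth_twist nth_Cons act_add split: nat.splits)

lemma twist_snoc:
  "length gs = length fs \<Longrightarrow> twist act (fs @ [f]) (gs @ [g]) = twist act fs gs @ [act (sum_list gs) f]"
  by (rule nth_equalityI) (auto simp: nth_twist nth_append less_Suc_eq)

lemma twist_replicate_zero: "twist act fs (replicate (length fs) 0) = fs"
proof (rule nth_equalityI)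
  have "sum_list (replicate i 0) = (0 :: 'g)" for i
    by (induction i) auto
  then show "twist act fs (replicate (length fs) 0) ! i = fs ! i"
    if "i < length (twist act fs (replicate (length fs) 0))" for i
    using that by (simp add: nth_twist)
qed simp

lemma map2_skew_elem_zero: "map2 skew_elem fs (replicate (length fs) 0) = map skew_embed fs"
  by (rule nth_equalityI) (auto simp: skew_embed_def)

text \<open>The product of f_1 g_1 and f_2 g_2 has the ring part f_1 times the translate of f_2 by
  g_1, which is the plain product of the twisted entries. Hence the inner faces match under
  \<open>theta_star\<close>.\<close>

lemma merge_map2_skew_elem:
  assumes "Suc i < length fs" "length gs = length fs"
  shows "\<exists>fs' gs'. length fs' = length fs - 1 \<and> length gs' = length fs'
    \<and> merge mult i (map2 skew_elem fs gs) = map2 skew_elem fs' gs'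
    \<and> twist act fs' gs' = merge (*) i (twist act fs gs) \<and> sum_list gs' = sum_list gs"
  using assms
proof (induction i arbitrary: fs gs)
  case 0
  then obtain f1 f2 fs' g1 g2 gs' where "fs = f1 # f2 # fs'" "gs = g1 # g2 # gs'"
    by (cases fs; cases "tl fs"; cases gs; cases "tl gs") auto
  with 0 show ?case
    by (intro exI[of _ "(f1 * act g1 f2) # fs'"] exI[of _ "(g1 + g2) # gs'"])
      (auto simp: twist_Cons skew_mult_skew_elem act_add add.assoc)
next
  case (Suc i)
  then obtain f fs1 g gs1 where *: "fs = f # fs1" "gs = g # gs1"
    by (auto simp: Suc_less_eq2 length_Suc_conv)
  from Suc.IH[of fs1 gs1] Suc.prems * obtain fs' gs' where
    "length fs' = length fs1 - 1" "length gs' = length fs'"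
    "merge mult i (map2 skew_elem fs1 gs1) = map2 skew_elem fs' gs'"
    "twist act fs' gs' = merge (*) i (twist act fs1 gs1)" "sum_list gs' = sum_list gs1"
    by auto
  with Suc.prems * show ?case
    by (intro exI[of _ "f # fs'"] exI[of _ "g # gs'"])
      (auto simp: twist_Cons map_merge[where h="act g" and m="(*)" and m'="(*)"] act_mult)
qed

lemma skew_decompose:
  fixes a :: "'g \<Rightarrow> 's"
  shows "a = (\<Sum>g\<in>UNIV. skew_elem (a g) g)"
  by (rule ext) (simp add: sum_fun_apply skew_elem_def)

lemma pure_list_conv_map2:
  "\<forall>y\<in>set ys. \<exists>s g. y = skew_elem s g \<Longrightarrow>
    \<exists>fs gs. length fs = length ys \<and> length gs = length ys \<and> map2 skew_elem fs gs = ys"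
proof (induction ys)
  case (Cons y ys)
  then obtain fs gs s g where
    "length fs = length ys" "length gs = length ys" "map2 skew_elem fs gs = ys" "y = skew_elem s g"
    by (meson list.set_intros)
  then show ?case
    by (intro exI[of _ "s # fs"] exI[of _ "g # gs"]) simp
qed simp

text \<open>Pure tensors span the tensor power; multilinearity expands one argument at a
  time.\<close>

lemma cochain_AA_eqI:
  assumes "f \<in> AA.C p" "f' \<in> AA.C p"
    and eq: "\<And>fs gs. length fs = p \<Longrightarrow> length gs = p \<Longrightarrow>
      f (map2 skew_elem fs gs) = f' (map2 skew_elem fs gs)"
  shows "f = f'"
proof
  \<comment> \<open>\<open>ys\<close> collects the entries already made pure, and the induction
    consumes \<open>xs\<close> from its right end.\<close>
  have "f (xs @ ys) = f' (xs @ ys)"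
    if "length xs + length ys = p" "\<forall>y\<in>set ys. \<exists>s g. y = skew_elem s g" for xs ys
    using that
  proof (induction xs arbitrary: ys rule: rev_induct)
    case Nil
    then obtain fs gs where "length fs = p" "length gs = p" "map2 skew_elem fs gs = ys"
      using pure_list_conv_map2[OF Nil.prems(2)] by (metis add_0 list.size(3))
    with eq show ?case by (metis append_Nil)
  next
    case (snoc a xs)
    let ?zs = "\<lambda>x. xs @ x # ys"
    have expand: "h (?zs a) = (\<Sum>g\<in>UNIV. h (?zs (skew_elem (a g) g)))" if "h \<in> AA.C p" for h
    proof -
      have "\<forall>xs i. length xs = p \<longrightarrow> i < p \<longrightarrow> Vector_Spaces.linear sk sk (\<lambda>x. h (xs[i := x]))"
        using that unfolding cochains_iff multilinear_def by (rule conjunct2)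
      from this[rule_format, of "?zs a" "length xs"]
      have "module_hom sk sk (\<lambda>x. h (?zs x))"
        using snoc.prems(1) by (simp add: Vector_Spaces.linear_iff_module_hom)
      from module_hom.sum[OF this, of "\<lambda>g. skew_elem (a g) g" UNIV] show ?thesis
        by (simp only: skew_decompose[of a, symmetric])
    qed
    have "f (?zs (skew_elem (a g) g)) = f' (?zs (skew_elem (a g) g))" for g
    proof (rule snoc.IH)
      show "length xs + length (skew_elem (a g) g # ys) = p" using snoc.prems(1) by simp
      show "\<forall>y\<in>set (skew_elem (a g) g # ys). \<exists>s g. y = skew_elem s g"
        using snoc.prems(2) by (metis set_ConsD)
    qed
    then show ?case
      by (simp only: append_assoc append_Cons append_Nil expand[OF assms(1)] expand[OF assms(2)])
  qed
  from this[of _ "[]"] have "f xs = f' xs" if "length xs = p" for xs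
    using that by (simp only: append_Nil2 list.size add_0_right list.set ball_empty)
  then show "f xs = f' xs" for xs
    using AA.cochain_length assms(1,2) by metis
qed

end

section \<open>Extension and restriction of cochains\<close>

context finite_group_action
begin

abbreviation "\<Theta> \<equiv> theta_star act"
abbreviation "R \<equiv> reynolds scale act"

definition restrict :: "(('g \<Rightarrow> 's) list \<Rightarrow> 'g \<Rightarrow> 's) \<Rightarrow> 's list \<Rightarrow> 'g \<Rightarrow> 's" where
  "restrict f = (\<lambda>fs. f (map skew_embed fs))"

lemma restrict_cochain:
  assumes "f \<in> AA.C p"
  shows "restrict f \<in> SA.C p"
proof -
  have "Vector_Spaces.linear scale sk (\<lambda>x. restrict f (fs[i := x]))" if "length fs = p" "i < p" for fs i
  proof -
    have "Vector_Spaces.linear sk sk (\<lambda>x. f ((map skew_embed fs)[i := x]))"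
      using assms that by (simp add: cochains_iff multilinear_def)
    from Vector_Spaces.linear_compose[OF linear_skew_embed this] show ?thesis
      by (simp add: restrict_def map_update o_def)
  qed
  then show ?thesis
    using assms by (simp add: cochains_iff multilinear_def restrict_def)
qed

text \<open>The embedding is multiplicative and S acts on A through it, so all three kinds of terms
  match.\<close>

lemma d_restrict: "SA.d p (restrict f) = restrict (AA.d p f)"
proof
  fix xs
  show "SA.d p (restrict f) xs = restrict (AA.d p f) xs"
  proof (cases "length xs = Suc p")
    case True
    then have "xs \<noteq> []" by auto
    with True show ?thesis
      by (simp add: restrict_def SA.d_eq AA.d_eq map_butlast map_tl last_map list.map_sel(1)
          map_merge[where h=skew_embed and m="(*)" and m'=mult, OF skew_embed_mult] del: power_Suc)
  qed (simp add: restrict_def SA.d_eq AA.d_eq)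
qed

lemma restrict_cocycle: "f \<in> AA.Z p \<Longrightarrow> restrict f \<in> SA.Z p"
  by (auto simp: cocycles_def restrict_cochain d_restrict) (simp add: restrict_def zero_fun_def)

lemma restrict_coboundary: "f \<in> AA.B p \<Longrightarrow> restrict f \<in> SA.B p"
  by (auto simp: coboundaries_def d_restrict[symmetric] restrict_cochain split: nat.splits)
    (simp add: restrict_def zero_fun_def)

text \<open>Only the summand of \<open>gs\<close> survives: for any other group list some coordinate
  is zero, and multilinearity makes \<open>\<kappa>\<close> vanish.\<close>

lemma theta_star_pure:
  assumes \<kappa>: "\<kappa> \<in> SA.C p" and gs: "length gs = length fs"
  shows "\<Theta> \<kappa> (map2 skew_elem fs gs) = mult (\<kappa> (twist act fs gs)) (grp (sum_list gs))"
proof -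
  let ?as = "map2 skew_elem fs gs"
  let ?t = "\<lambda>hs. mult (\<kappa> (twist act (map2 (\<lambda>a g. a g) ?as hs) hs)) (grp (sum_list hs))"
  have "?t hs = 0" if "length hs = length fs" "hs \<noteq> gs" for hs
  proof -
    have "\<exists>i<length fs. hs ! i \<noteq> gs ! i"
      using that gs nth_equalityI[of hs gs] by auto
    then obtain i where i: "i < length fs" "hs ! i \<noteq> gs ! i"
      by blast
    then have "\<kappa> (twist act (map2 (\<lambda>a g. a g) ?as hs) hs) = 0"
      using that gs by (intro SA.cochain_zero_arg[OF \<kappa>, of i]) (auto simp: nth_twist skew_elem_def)
    then show ?thesis
      using skew_mult_left_hom[THEN module_hom.zero] by simp
  qed
  then have "(\<Sum>hs | length hs = length ?as. ?t hs) = (\<Sum>hs\<in>{gs}. ?t hs)"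
    using gs by (intro sum.mono_neutral_right) (auto simp: finite_lists_of_length)
  moreover have "map2 (\<lambda>a g. a g) ?as gs = fs"
    using gs by (intro nth_equalityI) (auto simp: skew_elem_def)
  ultimately show ?thesis by (simp add: theta_star_def)
qed

lemma theta_star_cochain:
  assumes \<kappa>: "\<kappa> \<in> SA.C p"
  shows "\<Theta> \<kappa> \<in> AA.C p"
  unfolding cochains_iff
proof (intro conjI allI impI)
  fix as :: "('g \<Rightarrow> 's) list"
  assume "length as \<noteq> p"
  then have "\<kappa> (twist act (map2 (\<lambda>a g. a g) as gs) gs) = 0" if "length gs = length as" for gs
    using that by (intro SA.cochain_length[OF \<kappa>]) simp
  then show "\<Theta> \<kappa> as = 0"
    using skew_mult_left_hom[THEN module_hom.zero] by (simp add: theta_star_def)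
next
  have "Vector_Spaces.linear sk sk
      (\<lambda>x. mult (\<kappa> (twist act (map2 (\<lambda>a g. a g) (as[i := x]) gs) gs)) (grp (sum_list gs)))"
    if "length gs = p" "length as = p" "i < p" for as gs i
  proof -
    let ?fs = "map2 (\<lambda>a g. a g) as gs"
    have upd: "map2 (\<lambda>a g. a g) (as[i := x]) gs = ?fs[i := x (gs ! i)]" for x
      using that by (intro nth_equalityI) (auto simp: nth_list_update)
    have "Vector_Spaces.linear sk scale (\<lambda>x :: 'g \<Rightarrow> 's. x (gs ! i))"
      by (auto simp: Vector_Spaces.linear_iff vector_space_skew vector_space_axioms skew_scale_def)
    from Vector_Spaces.linear_compose[OF this act_linear]
    have "Vector_Spaces.linear sk scale (\<lambda>x. act (sum_list (take i gs)) (x (gs ! i)))"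
      by (simp add: o_def)
    moreover have "Vector_Spaces.linear scale sk (\<lambda>s. \<kappa> ((twist act ?fs gs)[i := s]))"
      using \<kappa> that by (simp add: cochains_iff multilinear_def)
    ultimately have "Vector_Spaces.linear sk sk
        (\<lambda>x. \<kappa> ((twist act ?fs gs)[i := act (sum_list (take i gs)) (x (gs ! i))]))"
      using Vector_Spaces.linear_compose by (fastforce simp: o_def)
    from Vector_Spaces.linear_compose[OF this linear_skew_mult_left] show ?thesis
      using that by (simp add: upd twist_update o_def)
  qed
  then have "multilinear sk sk p (\<lambda>as. \<Sum>gs | length gs = p.
      mult (\<kappa> (twist act (map2 (\<lambda>a g. a g) as gs) gs)) (grp (sum_list gs)))"
    by (intro AA.multilinear_sum) (simp add: multilinear_def)
  then show "multilinear sk sk p (\<Theta> \<kappa>)"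
    by (rule AA.multilinear_cong) (simp add: theta_star_def)
qed

text \<open>Elements of S carry the neutral group element, for which both the twist and the right
  factor disappear.\<close>

lemma restrict_theta_star:
  assumes "\<kappa> \<in> SA.C p"
  shows "restrict (\<Theta> \<kappa>) = \<kappa>"
proof
  fix fs
  have "sum_list (replicate n 0) = (0 :: 'g)" for n
    by (induction n) auto
  then show "restrict (\<Theta> \<kappa>) fs = \<kappa> fs"
    using theta_star_pure[OF assms, of "replicate (length fs) 0" fs]
    by (simp add: restrict_def map2_skew_elem_zero twist_replicate_zero)
qed

section \<open>The group action on cochains and averaging\<close>

lemma cochain_act_eq: "cochain_act act g \<kappa> fs = skew_conj act g (\<kappa> (map (act (- g)) fs))"
  by (simp add: cochain_act_def)

lemma act_inverse [simp]: "act g (act (- g) x) = x" "act (- g) (act g x) = x"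
  by (simp_all flip: act_add)

text \<open>Evaluation at translated arguments removes the inverse. In this form invariance lets a
  group element pass through \<open>\<kappa>\<close>.\<close>

lemma invariant_iff:
  "cochain_act act g \<kappa> = \<kappa> \<longleftrightarrow> (\<forall>fs. mult (grp g) (\<kappa> fs) = mult (\<kappa> (map (act g) fs)) (grp g))"
proof -
  have "cochain_act act g \<kappa> = \<kappa> \<longleftrightarrow> (\<forall>fs. cochain_act act g \<kappa> (map (act g) fs) = \<kappa> (map (act g) fs))"
  proof
    assume *: "\<forall>fs. cochain_act act g \<kappa> (map (act g) fs) = \<kappa> (map (act g) fs)"
    show "cochain_act act g \<kappa> = \<kappa>"
    proof
      show "cochain_act act g \<kappa> fs = \<kappa> fs" for fs
        using *[rule_format, of "map (act (- g)) fs"] by (simp add: o_def)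
    qed
  qed simp
  then show ?thesis
    by (simp add: cochain_act_eq skew_conj_eq_iff o_def)
qed

lemma cochain_act_cochain:
  assumes "\<kappa> \<in> SA.C p"
  shows "cochain_act act g \<kappa> \<in> SA.C p"
proof -
  have "Vector_Spaces.linear scale sk (\<lambda>x. cochain_act act g \<kappa> (fs[i := x]))" if "length fs = p" "i < p" for fs i
  proof -
    have "Vector_Spaces.linear scale sk (\<lambda>x. \<kappa> ((map (act (- g)) fs)[i := x]))"
      using assms that by (simp add: cochains_iff multilinear_def)
    from Vector_Spaces.linear_compose[OF Vector_Spaces.linear_compose[OF act_linear this] linear_skew_conj]
    show ?thesis
      by (simp add: cochain_act_eq map_update o_def)
  qed
  then show ?thesis
    using assms by (simp add: cochains_iff multilinear_def cochain_act_eq skew_conj_simps)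
qed

text \<open>Conjugation is an algebra automorphism of A extending the action on S, so it respects
  the products and both bimodule actions.\<close>

lemma cochain_act_d: "cochain_act act g (SA.d p \<kappa>) = SA.d p (cochain_act act g \<kappa>)"
proof
  fix xs
  show "cochain_act act g (SA.d p \<kappa>) xs = SA.d p (cochain_act act g \<kappa>) xs"
  proof (cases "length xs = Suc p")
    case True
    then have "xs \<noteq> []" by auto
    with True show ?thesis
      by (simp add: cochain_act_eq SA.d_eq skew_conj_simps skew_conj_mult skew_conj_embed
          map_butlast map_tl last_map list.map_sel(1)
          map_merge[where h="act (- g)" and m="(*)" and m'="(*)", OF act_mult] del: power_Suc)
  qed (simp add: cochain_act_eq SA.d_eq skew_conj_simps)
qed

lemma cochain_act_add: "cochain_act act g (\<kappa> + \<kappa>') = cochain_act act g \<kappa> + cochain_act act g \<kappa>'"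
  by (auto simp: fun_eq_iff cochain_act_eq skew_conj_simps)

lemma cochain_act_scale:
  "cochain_act act g (cochain_scale sk c \<kappa>) = cochain_scale sk c (cochain_act act g \<kappa>)"
  by (auto simp: fun_eq_iff cochain_act_eq skew_conj_simps cochain_scale_def)

lemma cochain_act_zero: "cochain_act act g 0 = 0"
  using cochain_act_add[of g 0 0] by simp

lemma cochain_act_sum: "cochain_act act g (\<Sum>i\<in>I. f i) = (\<Sum>i\<in>I. cochain_act act g (f i))"
  by (intro additive.sum[where f="cochain_act act g"] additive.intro cochain_act_add)

lemma cochain_act_cochain_act:
  "cochain_act act g (cochain_act act h \<kappa>) = cochain_act act (g + h) \<kappa>"
proof
  have "act (- (g + h)) = (\<lambda>x. act (- h) (act (- g) x))"
    by (rule ext) (simp only: minus_add act_add)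
  then show "cochain_act act g (cochain_act act h \<kappa>) fs = cochain_act act (g + h) \<kappa> fs" for fs
    by (simp only: cochain_act_eq skew_conj_add map_map o_def)
qed

lemma cochain_act_coboundary: "\<kappa> \<in> SA.B p \<Longrightarrow> cochain_act act g \<kappa> \<in> SA.B p"
  by (auto simp: coboundaries_def cochain_act_d cochain_act_cochain cochain_act_zero split: nat.splits)

lemma reynolds_cochain: "\<kappa> \<in> SA.C p \<Longrightarrow> R \<kappa> \<in> SA.C p"
  unfolding reynolds_def
  by (intro SA.F.subspace_scale SA.F.subspace_sum SA.subspace_cochains cochain_act_cochain)

lemma SA_d_sum: "SA.d p (\<Sum>i\<in>I. f i) = (\<Sum>i\<in>I. SA.d p (f i))"
  by (intro additive.sum[where f="SA.d p"] additive.intro SA.d_add)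

lemma reynolds_d: "R (SA.d p \<kappa>) = SA.d p (R \<kappa>)"
  by (simp add: reynolds_def cochain_act_d SA.d_scale SA_d_sum)

lemma reynolds_add: "R (\<kappa> + \<kappa>') = R \<kappa> + R \<kappa>'"
  by (simp add: reynolds_def cochain_act_add sum.distrib SA.F.scale_right_distrib)

lemma reynolds_scale: "R (cochain_scale sk c \<kappa>) = cochain_scale sk c (R \<kappa>)"
  by (simp add: reynolds_def cochain_act_scale SA.F.scale_sum_right[symmetric] mult.commute)

lemma reynolds_invariant: "cochain_act act g (R \<kappa>) = R \<kappa>"
proof -
  have "(\<Sum>h\<in>UNIV. cochain_act act (g + h) \<kappa>) = (\<Sum>h\<in>UNIV. cochain_act act h \<kappa>)"
    by (rule sum.reindex_bij_witness[of _ "\<lambda>h. - g + h" "\<lambda>h. g + h"]) simp_all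
  then show ?thesis
    by (simp add: reynolds_def cochain_act_scale cochain_act_sum cochain_act_cochain_act)
qed

text \<open>Each difference is a coboundary if the class of a cocycle \<open>\<kappa>\<close> is
  invariant, and zero if \<open>\<kappa>\<close> itself is; both cases are used below.\<close>

lemma reynolds_diff_eq:
  "R \<kappa> - \<kappa> = cochain_scale sk (1 / of_nat (card (UNIV :: 'g set))) (\<Sum>g\<in>UNIV. cochain_act act g \<kappa> - \<kappa>)"
  by (simp add: reynolds_def sum_subtractf SA.F.scale_right_diff_distrib SA.F.sum_constant_scale
      del: fun_diff_def)

lemma reynolds_of_invariant: "(\<And>g. cochain_act act g \<kappa> = \<kappa>) \<Longrightarrow> R \<kappa> = \<kappa>"
  using reynolds_diff_eq[of \<kappa>] by simp

lemma theta_star_add: "\<Theta> (\<kappa> + \<kappa>') = \<Theta> \<kappa> + \<Theta> \<kappa>'"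
  by (rule ext)
    (simp only: theta_star_def plus_fun_apply skew_mult_left_hom[THEN module_hom.add] sum.distrib)

lemma theta_star_scale: "\<Theta> (cochain_scale sk c \<kappa>) = cochain_scale sk c (\<Theta> \<kappa>)"
  by (simp add: theta_star_def cochain_scale_def skew_mult_left_hom[THEN module_hom.scale]
      AA.A.scale_sum_right)

section \<open>Extension as a chain map, and recovery of relative cochains\<close>

lemma d_theta_star:
  assumes \<kappa>: "\<kappa> \<in> SA.C p" and inv: "\<And>g. cochain_act act g \<kappa> = \<kappa>"
  shows "AA.d p (\<Theta> \<kappa>) = \<Theta> (SA.d p \<kappa>)"
proof (rule cochain_AA_eqI)
  show "AA.d p (\<Theta> \<kappa>) \<in> AA.C (Suc p)" "\<Theta> (SA.d p \<kappa>) \<in> AA.C (Suc p)"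
    using \<kappa> by (simp_all add: AA.d_cochain SA.d_cochain theta_star_cochain)
  fix fs :: "'s list" and gs :: "'g list"
  assume len: "length fs = Suc p" "length gs = Suc p"
  let ?as = "map2 skew_elem fs gs" and ?ts = "twist act fs gs" and ?s = "grp (sum_list gs)"
  \<comment> \<open>The leading \<open>grp g\<close> stands in front of \<open>\<kappa>\<close>;
    invariance carries it to the right and translates the arguments, as the twist demands.\<close>
  have "mult (hd ?as) (\<Theta> \<kappa> (tl ?as)) = mult (mult (skew_embed (hd ?ts)) (\<kappa> (tl ?ts))) ?s"
  proof -
    obtain f fs' g gs' where *: "fs = f # fs'" "gs = g # gs'" "length gs' = length fs'"
      using len by (auto simp: length_Suc_conv)
    have "mult (grp g) (\<kappa> (twist act fs' gs')) = mult (\<kappa> (map (act g) (twist act fs' gs'))) (grp g)"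
      using inv invariant_iff by blast
    then have "mult (grp g) (mult (\<kappa> (twist act fs' gs')) b)
        = mult (\<kappa> (map (act g) (twist act fs' gs'))) (mult (grp g) b)" for b
      by (metis skew_mult_assoc)
    then show ?thesis
      using * by (simp add: theta_star_pure[OF \<kappa>] twist_Cons skew_elem_eq[of f] AA.\<gamma>_add skew_mult_assoc)
  qed
  moreover have "\<Theta> \<kappa> (merge mult i ?as) = mult (\<kappa> (merge (*) i ?ts)) ?s" if "i < p" for i
  proof -
    from merge_map2_skew_elem[of i fs gs] that len obtain fs' gs' where
      "length gs' = length fs'" "merge mult i ?as = map2 skew_elem fs' gs'"
      "twist act fs' gs' = merge (*) i ?ts" "sum_list gs' = sum_list gs"
      by auto
    then show ?thesis by (simp add: theta_star_pure[OF \<kappa>])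
  qed
  \<comment> \<open>The product of the earlier group elements acts on the last ring element while
    passing it, which produces the last entry of the twist.\<close>
  moreover have "mult (\<Theta> \<kappa> (butlast ?as)) (last ?as)
      = mult (mult (\<kappa> (butlast ?ts)) (skew_embed (last ?ts))) ?s"
  proof -
    obtain f fs' g gs' where *: "fs = fs' @ [f]" "gs = gs' @ [g]" "length gs' = length fs'"
      using len by (cases fs rule: rev_cases; cases gs rule: rev_cases) auto
    have "mult (grp h) (mult (skew_embed s) b) = mult (skew_embed (act h s)) (mult (grp h) b)" for h s b
      by (metis skew_mult_assoc grp_mult_embed)
    then show ?thesis
      using * by (simp add: theta_star_pure[OF \<kappa>] twist_snoc skew_elem_eq[of f] AA.\<gamma>_add skew_mult_assoc)
  qed
  moreover have "\<Theta> (SA.d p \<kappa>) ?as = mult (SA.d p \<kappa> ?ts) ?s"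
    using len by (intro theta_star_pure[OF SA.d_cochain[OF \<kappa>]]) simp
  ultimately show "AA.d p (\<Theta> \<kappa>) ?as = \<Theta> (SA.d p \<kappa>) ?as"
    using len by (simp add: AA.d_eq SA.d_eq skew_mult_left_hom[THEN module_hom.add]
        skew_mult_left_hom[THEN module_hom.scale] skew_mult_left_hom[THEN module_hom.sum]
        del: power_Suc)
qed

text \<open>The travelling group element translates each ring element, collects the next group
  element, and is absorbed by the right slot. Arbitrary \<open>xs\<close>, \<open>a\<close> and
  \<open>g\<close> serve the induction; \<open>g = 0\<close> leads to the formula for
  \<open>theta_star\<close>, a list of zeros as \<open>gs\<close> to invariance.\<close>

lemma bar_slide:
  assumes F: "AA.relative p F" and "length gs = length fs" "length xs + length fs = p"
  shows "F (xs @ mult a (grp g) # map2 skew_elem fs gs @ [c])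
    = F (xs @ a # map (\<lambda>f. skew_embed (act g f)) (twist act fs gs) @ [mult (grp (g + sum_list gs)) c])"
  using assms(2,3)
proof (induction gs fs arbitrary: xs a g rule: list_induct2)
  case Nil
  then show ?case
    using F unfolding AA.relative_def by (auto simp: twist_def)
next
  case (Cons g1 gs f fs)
  have "F (xs @ mult a (grp g) # skew_elem f g1 # map2 skew_elem fs gs @ [c])
      = F (xs @ a # mult (grp g) (skew_elem f g1) # map2 skew_elem fs gs @ [c])"
    using F Cons.hyps Cons.prems unfolding AA.relative_def by auto
  also have "mult (grp g) (skew_elem f g1) = mult (skew_embed (act g f)) (grp (g + g1))"
    by (simp add: skew_embed_def skew_mult_skew_elem)
  finally show ?case
    using Cons.IH[of "xs @ [a]" "skew_embed (act g f)" "g + g1"] Cons.prems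
    by (simp add: twist_Cons act_add add.assoc o_def)
qed

text \<open>Sliding starts with the neutral element in the left slot; what arrives in the right slot
  is the right factor in \<open>theta_star_pure\<close>.\<close>

lemma theta_star_restrict:
  assumes f: "f \<in> AA.C p" and rel: "AA.relative p (AA.bar f)"
  shows "\<Theta> (restrict f) = f"
proof (rule cochain_AA_eqI[OF theta_star_cochain[OF restrict_cochain[OF f]] f])
  fix fs :: "'s list" and gs :: "'g list"
  assume len: "length fs = p" "length gs = p"
  have "f (map2 skew_elem fs gs) = AA.bar f (skew_embed 1 # map2 skew_elem fs gs @ [skew_embed 1])"
    by simp
  also have "\<dots> = AA.bar f (skew_embed 1 # map skew_embed (twist act fs gs) @ [grp (sum_list gs)])"
    using bar_slide[OF rel, of gs fs "[]" "skew_embed 1" 0 "skew_embed 1"] len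
    by (simp del: AA.bar_snoc)
  also have "\<dots> = \<Theta> (restrict f) (map2 skew_elem fs gs)"
    using len theta_star_pure[OF restrict_cochain[OF f], of gs fs] by (simp add: restrict_def)
  finally show "\<Theta> (restrict f) (map2 skew_elem fs gs) = f (map2 skew_elem fs gs)" ..
qed

text \<open>Sliding carries \<open>grp g\<close> from the left bimodule slot to the right one past
  arguments from S, which is invariance in its commutation form.\<close>

lemma restrict_invariant:
  assumes f: "f \<in> AA.C p" and rel: "AA.relative p (AA.bar f)"
  shows "cochain_act act g (restrict f) = restrict f"
  unfolding invariant_iff
proof
  fix fs :: "'s list"
  show "mult (grp g) (restrict f fs) = mult (restrict f (map (act g) fs)) (grp g)"
  proof (cases "length fs = p")
    case True
    have z: "sum_list (replicate n 0) = (0 :: 'g)" for n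
      by (induction n) auto
    have "mult (grp g) (restrict f fs)
        = AA.bar f (grp g # map2 skew_elem fs (replicate (length fs) 0) @ [skew_embed 1])"
      by (simp add: restrict_def map2_skew_elem_zero)
    also have "\<dots> = AA.bar f (skew_embed 1 # map (\<lambda>f. skew_embed (act g f)) fs @ [grp g])"
      using bar_slide[OF rel, of "replicate (length fs) 0" fs "[]" "skew_embed 1" g "skew_embed 1"]
        True twist_replicate_zero[of fs]
      by (simp add: z del: AA.bar_snoc)
    also have "\<dots> = mult (restrict f (map (act g) fs)) (grp g)"
      by (simp add: restrict_def o_def)
    finally show ?thesis .
  next
    case False
    then show ?thesis
      using AA.cochain_length[OF f] AA.lm_simps(4)[of "grp g"] AA.rm_simps(4)[of "grp g"]
      by (simp add: restrict_def)
  qed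
qed

end

section \<open>The induced isomorphism\<close>

context vector_space
begin

lemma coset_eq_iff:
  assumes "subspace B"
  shows "x +o B = y +o B \<longleftrightarrow> x - y \<in> B"
proof
  assume "x +o B = y +o B"
  moreover have "x \<in> x +o B"
    using subspace_0[OF assms] by (force simp: elt_set_plus_def)
  ultimately show "x - y \<in> B"
    by (simp add: set_minus_plus)
next
  assume *: "x - y \<in> B"
  have "\<exists>b'\<in>B. x + b = y + b'" if "b \<in> B" for b
    using subspace_add[OF assms * that] by (force simp: algebra_simps)
  moreover have "\<exists>b'\<in>B. y + b = x + b'" if "b \<in> B" for b
    using subspace_diff[OF assms that *] by (force simp: algebra_simps)
  ultimately show "x +o B = y +o B"
    by (auto simp: elt_set_plus_def)
qed

text \<open>All members of the union coincide, so any representative computes the induced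
  map.\<close>

lemma induced_map_coset:
  assumes B: "subspace B" and "0 \<in> A"
    and add: "\<And>x y. F (x + y) = F x + F y" and A: "\<And>a. a \<in> A \<Longrightarrow> F a \<in> B"
  shows "induced_map B F (z +o A) = F z +o B"
proof -
  have "F (z + a) +o B = F z +o B" if "a \<in> A" for a
    using A[OF that] by (simp add: coset_eq_iff[OF B] add)
  moreover have "z +o A = (\<lambda>a. z + a) ` A"
    by (auto simp: elt_set_plus_def)
  ultimately show ?thesis
    using \<open>0 \<in> A\<close> by (auto simp: induced_map_def)
qed

lemma coset_add:
  assumes "subspace B"
  shows "(x +o B) + (y +o B) = (x + y) +o B"
proof -
  have "B + B = B"
    using subspace_add[OF assms] subspace_0[OF assms]
    by (auto elim!: set_plus_elim) (metis add_0_right set_plus_intro)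
  then show ?thesis by (simp add: set_plus_rearrange)
qed

end

context finite_group_action
begin

section \<open>The map on cohomology classes\<close>

abbreviation "\<Phi> \<equiv> \<Theta> \<circ> R"

lemma \<Phi>_add: "\<Phi> (\<kappa> + \<kappa>') = \<Phi> \<kappa> + \<Phi> \<kappa>'"
  by (simp only: o_def reynolds_add theta_star_add)

lemma \<Phi>_scale: "\<Phi> (cochain_scale sk c \<kappa>) = cochain_scale sk c (\<Phi> \<kappa>)"
  by (simp only: o_def reynolds_scale theta_star_scale)

lemma \<Phi>_diff: "\<Phi> (\<kappa> - \<kappa>') = \<Phi> \<kappa> - \<Phi> \<kappa>'"
  by (intro additive.diff[where f="\<Phi>"] additive.intro \<Phi>_add)

lemma \<Phi>_zero: "\<Phi> 0 = 0"
  by (intro additive.zero[where f="\<Phi>"] additive.intro \<Phi>_add)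

lemma \<Phi>_cochain: "\<kappa> \<in> SA.C p \<Longrightarrow> \<Phi> \<kappa> \<in> AA.C p"
  by (simp add: theta_star_cochain reynolds_cochain)

lemma d_\<Phi>: "\<kappa> \<in> SA.C p \<Longrightarrow> AA.d p (\<Phi> \<kappa>) = \<Phi> (SA.d p \<kappa>)"
  by (simp add: d_theta_star reynolds_cochain reynolds_invariant reynolds_d)

lemma \<Phi>_cocycle: "\<kappa> \<in> SA.Z p \<Longrightarrow> \<Phi> \<kappa> \<in> AA.Z p"
  unfolding cocycles_def using d_\<Phi> \<Phi>_cochain \<Phi>_zero by (metis (mono_tags, lifting) mem_Collect_eq)

lemma \<Phi>_coboundary: "\<kappa> \<in> SA.B p \<Longrightarrow> \<Phi> \<kappa> \<in> AA.B p"
proof (cases p)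
  case 0
  then show "\<kappa> \<in> SA.B p \<Longrightarrow> \<Phi> \<kappa> \<in> AA.B p"
    using \<Phi>_zero by (simp add: coboundaries_def del: o_apply)
next
  case (Suc q)
  assume "\<kappa> \<in> SA.B p"
  then obtain \<eta> where "\<eta> \<in> SA.C q" "\<kappa> = SA.d q \<eta>"
    by (auto simp: coboundaries_def Suc)
  then have "\<Phi> \<kappa> = AA.d q (\<Phi> \<eta>)" "\<Phi> \<eta> \<in> AA.C q"
    by (simp_all only: d_\<Phi> \<Phi>_cochain)
  then show "\<Phi> \<kappa> \<in> AA.B p"
    by (simp add: coboundaries_def Suc)
qed

lemma induced_\<Phi>: "induced_map (AA.B p) \<Phi> (\<kappa> +o SA.B p) = \<Phi> \<kappa> +o AA.B p"
  by (intro AA.F.induced_map_coset AA.subspace_coboundaries SA.F.subspace_0 SA.subspace_coboundaries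
      \<Phi>_add \<Phi>_coboundary)

lemma induced_cochain_act:
  "induced_map (SA.B p) (cochain_act act g) (\<kappa> +o SA.B p) = cochain_act act g \<kappa> +o SA.B p"
  by (intro SA.F.induced_map_coset SA.F.subspace_0 SA.subspace_coboundaries
      cochain_act_add cochain_act_coboundary)

lemma reynolds_invariant_class:
  assumes "\<And>g. induced_map (SA.B p) (cochain_act act g) (\<kappa> +o SA.B p) = \<kappa> +o SA.B p"
  shows "R \<kappa> - \<kappa> \<in> SA.B p"
proof -
  have "cochain_act act g \<kappa> - \<kappa> \<in> SA.B p" for g
    using assms[of g] by (simp only: induced_cochain_act SA.F.coset_eq_iff[OF SA.subspace_coboundaries])
  then show ?thesis
    unfolding reynolds_diff_eq
    by (intro SA.F.subspace_scale SA.F.subspace_sum SA.subspace_coboundaries)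
qed

text \<open>Restriction preserves coboundaries and recovers \<open>R \<kappa>\<close> from
  \<open>\<Phi> \<kappa>\<close>.\<close>

lemma reynolds_coboundary_if_\<Phi>_coboundary:
  assumes "\<kappa> \<in> SA.C p" "\<Phi> \<kappa> \<in> AA.B p"
  shows "R \<kappa> \<in> SA.B p"
  using restrict_coboundary[OF assms(2)] restrict_theta_star[OF reynolds_cochain[OF assms(1)]]
  by simp

definition invariant_classes :: "nat \<Rightarrow> ('s list \<Rightarrow> 'g \<Rightarrow> 's) set set" where
  "invariant_classes p = {X \<in> quotient_space (SA.Z p) (SA.B p).
     \<forall>g. induced_map (SA.B p) (cochain_act act g) X = X}"

lemma \<Phi>_inj: "inj_on (induced_map (AA.B p) \<Phi>) (invariant_classes p)"
proof (rule inj_onI)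
  fix X Y
  assume X: "X \<in> invariant_classes p" and Y: "Y \<in> invariant_classes p"
    and img: "induced_map (AA.B p) \<Phi> X = induced_map (AA.B p) \<Phi> Y"
  from X obtain x where x: "x \<in> SA.Z p" "X = x +o SA.B p"
    by (auto simp: invariant_classes_def quotient_space_def)
  from Y obtain y where y: "y \<in> SA.Z p" "Y = y +o SA.B p"
    by (auto simp: invariant_classes_def quotient_space_def)
  have "\<Phi> (x - y) \<in> AA.B p"
    using img unfolding x y induced_\<Phi> AA.F.coset_eq_iff[OF AA.subspace_coboundaries] \<Phi>_diff .
  moreover have "x - y \<in> SA.C p"
    using SA.F.subspace_diff[OF SA.subspace_cocycles x(1) y(1)] by (simp add: cocycles_def)
  ultimately have 1: "R (x - y) \<in> SA.B p"
    by (intro reynolds_coboundary_if_\<Phi>_coboundary)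
  have inv: "R x - x \<in> SA.B p" "R y - y \<in> SA.B p"
    using X Y x y by (auto intro!: reynolds_invariant_class simp: invariant_classes_def)
  have "R (x - y) = R x - R y"
    by (intro additive.diff[where f=R] additive.intro reynolds_add)
  \<comment> \<open>Averaging keeps each representative in its class, so \<open>x - y\<close> is
    assembled from three coboundaries.\<close>
  then have eq: "R (x - y) - (R x - x) + (R y - y) = x - y"
    by (simp only: algebra_simps)
  have "R (x - y) - (R x - x) + (R y - y) \<in> SA.B p"
    by (rule SA.F.subspace_add[OF SA.subspace_coboundaries
          SA.F.subspace_diff[OF SA.subspace_coboundaries 1 inv(1)] inv(2)])
  then show "X = Y"
    unfolding eq x y SA.F.coset_eq_iff[OF SA.subspace_coboundaries] .
qed

lemma \<Phi>_surj: "induced_map (AA.B p) \<Phi> ` invariant_classes p = quotient_space (AA.Z p) (AA.B p)"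
proof (intro equalityI subsetI)
  fix W assume "W \<in> induced_map (AA.B p) \<Phi> ` invariant_classes p"
  then obtain x where x: "x \<in> SA.Z p" "W = induced_map (AA.B p) \<Phi> (x +o SA.B p)"
    by (auto simp: invariant_classes_def quotient_space_def)
  then show "W \<in> quotient_space (AA.Z p) (AA.B p)"
    unfolding quotient_space_def x(2) induced_\<Phi> using \<Phi>_cocycle by blast
next
  fix W assume "W \<in> quotient_space (AA.Z p) (AA.B p)"
  then obtain f where f: "f \<in> AA.Z p" "W = f +o AA.B p"
    by (auto simp: quotient_space_def)
  obtain f' where f': "f' \<in> AA.Z p" "f - f' \<in> AA.B p" and rel: "AA.relative p (AA.bar f')"
    using AA.cohomologous_relative_cocycle[OF f(1)] by blast
  let ?\<kappa> = "restrict f'"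
  have C: "f' \<in> AA.C p" using f'(1) by (simp add: cocycles_def)
  have inv: "cochain_act act g ?\<kappa> = ?\<kappa>" for g
    by (rule restrict_invariant[OF C rel])
  \<comment> \<open>\<open>R\<close> fixes the invariant restriction, and a relative cocycle is the
    extension of its restriction.\<close>
  have "\<Phi> ?\<kappa> = f'"
    by (simp add: reynolds_of_invariant inv theta_star_restrict[OF C rel])
  then have "W = induced_map (AA.B p) \<Phi> (?\<kappa> +o SA.B p)"
    unfolding induced_\<Phi> f(2) AA.F.coset_eq_iff[OF AA.subspace_coboundaries] using f'(2) by simp
  moreover have "?\<kappa> +o SA.B p \<in> invariant_classes p"
    unfolding invariant_classes_def quotient_space_def
    using restrict_cocycle[OF f'(1)] by (simp add: induced_cochain_act inv)
  ultimately show "W \<in> induced_map (AA.B p) \<Phi> ` invariant_classes p"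
    by blast
qed

lemma SA_scale_coset:
  "induced_map (SA.B p) (cochain_scale sk c) (x +o SA.B p) = cochain_scale sk c x +o SA.B p"
  by (intro SA.F.induced_map_coset SA.subspace_coboundaries SA.F.subspace_0
      SA.F.scale_right_distrib SA.F.subspace_scale)

lemma AA_scale_coset:
  "induced_map (AA.B p) (cochain_scale sk c) (x +o AA.B p) = cochain_scale sk c x +o AA.B p"
  by (intro AA.F.induced_map_coset AA.subspace_coboundaries AA.F.subspace_0
      AA.F.scale_right_distrib AA.F.subspace_scale)

theorem \<Phi>_linear_isomorphism:
  "linear_isomorphism (\<lambda>c. induced_map (SA.B p) (cochain_scale sk c))
     (\<lambda>c. induced_map (AA.B p) (cochain_scale sk c))
     (invariant_classes p) (quotient_space (AA.Z p) (AA.B p)) (induced_map (AA.B p) \<Phi>)"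
  unfolding linear_isomorphism_def
proof (intro conjI ballI allI)
  fix X Y assume "X \<in> invariant_classes p" "Y \<in> invariant_classes p"
  then obtain x y where "X = x +o SA.B p" "Y = y +o SA.B p"
    by (auto simp: invariant_classes_def quotient_space_def)
  then show "induced_map (AA.B p) \<Phi> (X + Y) = induced_map (AA.B p) \<Phi> X + induced_map (AA.B p) \<Phi> Y"
    by (simp only: SA.F.coset_add[OF SA.subspace_coboundaries]
        AA.F.coset_add[OF AA.subspace_coboundaries] induced_\<Phi> \<Phi>_add)
next
  fix c X assume "X \<in> invariant_classes p"
  then obtain x where "X = x +o SA.B p"
    by (auto simp: invariant_classes_def quotient_space_def)
  then show "induced_map (AA.B p) \<Phi> (induced_map (SA.B p) (cochain_scale sk c) X)
      = induced_map (AA.B p) (cochain_scale sk c) (induced_map (AA.B p) \<Phi> X)"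
    by (simp only: SA_scale_coset AA_scale_coset induced_\<Phi> \<Phi>_scale)
next
  show "bij_betw (induced_map (AA.B p) \<Phi>) (invariant_classes p) (quotient_space (AA.Z p) (AA.B p))"
    unfolding bij_betw_def using \<Phi>_inj \<Phi>_surj by blast
qed

text \<open>Right multiplication is linear, so the scalar and the group sum pass through it.\<close>

lemma \<Phi>_pure:
  assumes "\<beta> \<in> SA.C p" "length fs = p" "length gs = p"
  shows "\<Theta> (R \<beta>) (map2 skew_elem fs gs) =
    sk (1 / of_nat (card (UNIV :: 'g set)))
      (\<Sum>g\<in>UNIV. mult (cochain_act act g \<beta> (twist act fs gs)) (grp (sum_list gs)))"
proof -
  have "R \<beta> xs = sk (1 / of_nat (card (UNIV :: 'g set))) (\<Sum>g\<in>UNIV. cochain_act act g \<beta> xs)" for xs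
    by (simp only: reynolds_def cochain_scale_def sum_fun_apply)
  then show ?thesis
    using assms by (simp only: theta_star_pure[OF reynolds_cochain]
        skew_mult_left_hom[THEN module_hom.scale] skew_mult_left_hom[THEN module_hom.sum])
qed

end

theorem theorem3p4:
  fixes scale :: "complex \<Rightarrow> 's::{ring,monoid_mult} \<Rightarrow> 's"
    and act :: "'g::{group_add,finite} \<Rightarrow> 's \<Rightarrow> 's"
    and p :: nat
  assumes "finite_group_action scale act"
  shows
    "(\<forall>\<beta> \<in> cochains_SA scale p. theta_star act (reynolds scale act \<beta>) \<in> cochains_AA scale p)
   \<and> (\<forall>\<beta> \<in> cochains_SA scale p. \<forall>fs gs. length fs = p \<and> length gs = p \<longrightarrow>
        theta_star act (reynolds scale act \<beta>) (map2 skew_elem fs gs) =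
        skew_scale scale (1 / of_nat (card (UNIV :: 'g set)))
          (\<Sum>g\<in>UNIV. skew_mult act (cochain_act act g \<beta> (twist act fs gs))
                        (skew_elem 1 (sum_list gs))))
   \<and> (\<forall>\<beta> \<in> cocycles_SA scale act p. theta_star act (reynolds scale act \<beta>) \<in> cocycles_AA scale act p)
   \<and> (\<forall>\<beta> \<in> coboundaries_SA scale act p.
        theta_star act (reynolds scale act \<beta>) \<in> coboundaries_AA scale act p)
   \<and> (\<forall>\<beta> \<in> cocycles_SA scale act p.
        induced_map (coboundaries_AA scale act p) (theta_star act \<circ> reynolds scale act)
          (\<beta> +o coboundaries_SA scale act p)
        = theta_star act (reynolds scale act \<beta>) +o coboundaries_AA scale act p)
   \<and> linear_isomorphism (HH_SA_scale scale act p) (HH_AA_scale scale act p)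
        (HH_SA_invariants scale act p) (HH_AA scale act p)
        (induced_map (coboundaries_AA scale act p) (theta_star act \<circ> reynolds scale act))"
proof -
  interpret finite_group_action scale act by fact
  \<comment> \<open>The constants of the statement unfold to those of the two bimodule
    interpretations, so the results above transfer.\<close>
  have scales: "HH_SA_scale scale act p = (\<lambda>c. induced_map (SA.B p) (cochain_scale sk c))"
    "HH_AA_scale scale act p = (\<lambda>c. induced_map (AA.B p) (cochain_scale sk c))"
    by (simp_all only: fun_eq_iff HH_SA_scale_def HH_AA_scale_def coboundaries_SA_def coboundaries_AA_def) simp_all
  have spaces: "HH_SA_invariants scale act p = invariant_classes p"
    "HH_AA scale act p = quotient_space (AA.Z p) (AA.B p)"
    by (simp_all only: HH_SA_invariants_def HH_SA_def HH_AA_def invariant_classes_def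
        coboundaries_SA_def coboundaries_AA_def cocycles_SA_def cocycles_AA_def)
  have defs: "cochains_SA scale p = SA.C p" "cochains_AA scale p = AA.C p"
    "cocycles_SA scale act p = SA.Z p" "cocycles_AA scale act p = AA.Z p"
    "coboundaries_SA scale act p = SA.B p" "coboundaries_AA scale act p = AA.B p"
    by (simp_all only: cochains_SA_def cochains_AA_def
        coboundaries_SA_def coboundaries_AA_def cocycles_SA_def cocycles_AA_def)
  show ?thesis
    unfolding defs scales spaces
    using \<Phi>_cochain \<Phi>_pure \<Phi>_cocycle \<Phi>_coboundary induced_\<Phi> \<Phi>_linear_isomorphism
    unfolding o_apply by blast
qed

end
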